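(* Let $p\ge 2$, $-\infty\le a<b\le+\infty$, let $h:(0,\infty)\to(0,\infty)$ be a continuous function, let $H:(0,\infty)\to\mathbb{R}$ be a locally absolutely continuous primitive of $h$ and $\mathcal{T}_h:=H/h$. Let $f\in W^{2,1}_{loc}((a,b))$ be a function which does not have single zeroes. Assume that at least one of the following conditions holds: 1. $H$ extends to a continuous function $\tilde H:[0,\infty)\to\mathbb{R}$, and $$\liminf_{R\nearrow b}|f'(R)|^{p-2}f'(R)\,\mathrm{sign}(f(R))\tilde H(|f(R)|)\le 0,\qquad \limsup_{r\searrow a}|f'(r)|^{p-2}f'(r)\,\mathrm{sign}(f(r))\tilde H(|f(r)|)\ge 0;$$ 2. each of the functions $h$ and $|\mathcal{T}_h|^{\frac p2}h$ is either bounded or nonincreasing in some neighborhood of $0$, and, with $\tilde H$ denoting the (not necessarily continuous) extension of $H$ to $[0,\infty)$ given by $\tilde H(0)=0$, $$\liminf_{R\nearrow b}|f'(R)|^{p-2}f'(R)\,\mathrm{sign}(f(R))\tilde H(|f(R)|)-\limsup_{r\searrow a}|f'(r)|^{p-2}f'(r)\,\mathrm{sign}(f(r))\tilde H(|f(r)|)\le 0 .$$ Then $$\int_{(a,b)\cap\{x:f(x)\ne 0\}}|f'(x)|^p h(|f(x)|)\,dx\le\left(\sqrt{p-1}\right)^p\int_{(a,b)\cap\{x:f(x)\ne 0\}}\left|f''(x)\,\mathcal{T}_h(|f(x)|)\right|^{\frac p2}h(|f(x)|)\,dx .$$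
   Context: A function $f$ does not have single zeroes if $f'(x)=0$ whenever $f(x)=0$. "In some neighborhood of $0$" means on some interval $(0,\epsilon]$, $\epsilon>0$. Here $f\in W^{2,1}_{loc}$ is identified with its $C^1$ representative whose derivative $f'$ is locally absolutely continuous; $f''$ is the a.e. defined second derivative. Functions are real valued, and integrals of nonnegative functions are taken in $[0,+\infty]$. *)

theory Defs
  imports "HOL-Analysis.Analysis"
begin

text \<open>
  The usual epsilon-delta definition on an interval \<open>S\<close>. A \<open>division_of\<close> is a finite family of
  nonempty, non-overlapping compact intervals \<open>{u..v}\<close>, for which \<open>Inf k = u\<close> and \<open>Sup k = v\<close>.
\<close>
definition abs_cont_on :: "real set \<Rightarrow> (real \<Rightarrow> real) \<Rightarrow> bool" where
  "abs_cont_on S F \<longleftrightarrow>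
     (\<forall>\<epsilon>>0. \<exists>\<delta>>0. \<forall>\<D> T. \<D> division_of T \<and> T \<subseteq> S \<and> (\<Sum>k\<in>\<D>. Sup k - Inf k) < \<delta>
        \<longrightarrow> (\<Sum>k\<in>\<D>. \<bar>F (Sup k) - F (Inf k)\<bar>) < \<epsilon>)"

definition loc_abs_cont_on :: "real set \<Rightarrow> (real \<Rightarrow> real) \<Rightarrow> bool" where
  "loc_abs_cont_on S F \<longleftrightarrow> (\<forall>c d. c \<le> d \<longrightarrow> {c..d} \<subseteq> S \<longrightarrow> abs_cont_on {c..d} F)"

text \<open>
  Elements of \<open>W\<^sup>2\<^sup>,\<^sup>1\<close>, locally on \<open>(a,b)\<close>, are identified with their continuously differentiable
  representatives. Continuity of the first derivative follows from its local absolute continuity.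
\<close>
definition W21_loc :: "ereal \<Rightarrow> ereal \<Rightarrow> (real \<Rightarrow> real) set" where
  "W21_loc a b = {f. (\<forall>x\<in>einterval a b. f differentiable (at x)) \<and>
                     loc_abs_cont_on (einterval a b) (deriv f)}"

definition is_ae_deriv_on :: "real set \<Rightarrow> (real \<Rightarrow> real) \<Rightarrow> (real \<Rightarrow> real) \<Rightarrow> bool" where
  "is_ae_deriv_on S F g \<longleftrightarrow> (AE x in lebesgue. x \<in> S \<longrightarrow> (F has_real_derivative g x) (at x))"

definition no_single_zeroes :: "ereal \<Rightarrow> ereal \<Rightarrow> (real \<Rightarrow> real) \<Rightarrow> bool" where
  "no_single_zeroes a b f \<longleftrightarrow> (\<forall>x\<in>einterval a b. f x = 0 \<longrightarrow> deriv f x = 0)"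

definition bounded_or_noninc_near_0 :: "(real \<Rightarrow> real) \<Rightarrow> bool" where
  "bounded_or_noninc_near_0 g \<longleftrightarrow>
     (\<exists>\<epsilon>>0. bounded (g ` {0<..\<epsilon>}) \<or> antimono_on {0<..\<epsilon>} g)"

definition T_trans :: "(real \<Rightarrow> real) \<Rightarrow> (real \<Rightarrow> real) \<Rightarrow> real \<Rightarrow> real" where
  "T_trans H h t = H t / h t"

text \<open>
  The convention \<open>0 powr 0 = 0\<close> is harmless for \<open>p = 2\<close>, since the power is multiplied by
  \<open>deriv f x\<close>.
\<close>
definition bdry :: "real \<Rightarrow> (real \<Rightarrow> real) \<Rightarrow> (real \<Rightarrow> real) \<Rightarrow> real \<Rightarrow> real" where
  "bdry p K f x = \<bar>deriv f x\<bar> powr (p - 2) * deriv f x * sgn (f x) * K \<bar>f x\<bar>"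

text \<open>
  One-sided lower and upper limits at the possibly infinite endpoints, as extended reals. Near the
  endpoint, the points of \<open>at_left b\<close> and \<open>at_right a\<close> in \<^typ>\<open>ereal\<close> are finite when \<open>a < b\<close>.
\<close>
definition liminf_left :: "ereal \<Rightarrow> (real \<Rightarrow> real) \<Rightarrow> ereal" where
  "liminf_left b F = Liminf (at_left b) (\<lambda>R. ereal (F (real_of_ereal R)))"

definition limsup_right :: "ereal \<Rightarrow> (real \<Rightarrow> real) \<Rightarrow> ereal" where
  "limsup_right a F = Limsup (at_right a) (\<lambda>r. ereal (F (real_of_ereal r)))"

definition boundary_cond_1 ::
  "real \<Rightarrow> ereal \<Rightarrow> ereal \<Rightarrow> (real \<Rightarrow> real) \<Rightarrow> (real \<Rightarrow> real) \<Rightarrow> bool" where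
  "boundary_cond_1 p a b H f \<longleftrightarrow>
     (\<exists>Ht. continuous_on {0..} Ht \<and> (\<forall>t>0. Ht t = H t) \<and>
           liminf_left b (bdry p Ht f) \<le> 0 \<and> limsup_right a (bdry p Ht f) \<ge> 0)"

text \<open>
  In \<^typ>\<open>ereal\<close>, \<open>\<infinity> - \<infinity>\<close> and \<open>-\<infinity> - (-\<infinity>)\<close> both equal \<open>\<infinity>\<close>. Hence the inequality below
  fails whenever the difference is undefined in the usual sense.
\<close>
definition boundary_cond_2 ::
  "real \<Rightarrow> ereal \<Rightarrow> ereal \<Rightarrow> (real \<Rightarrow> real) \<Rightarrow> (real \<Rightarrow> real) \<Rightarrow> (real \<Rightarrow> real) \<Rightarrow> bool" where
  "boundary_cond_2 p a b h H f \<longleftrightarrow>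
     bounded_or_noninc_near_0 h \<and>
     bounded_or_noninc_near_0 (\<lambda>t. \<bar>T_trans H h t\<bar> powr (p / 2) * h t) \<and>
     (let Ht = (\<lambda>t. if t = 0 then 0 else H t)
      in liminf_left b (bdry p Ht f) - limsup_right a (bdry p Ht f) \<le> 0)"

end

theory Submission
  imports Defs
begin

text \<open>
  On the set where \<open>f \<noteq> 0\<close>, the boundary term \<open>\<bar>f'\<bar> powr (p - 2) * f' * sgn f * H \<bar>f\<bar>\<close> is locally
  absolutely continuous. Its derivative is the left-hand integrand plus a term that
  Young's inequality (\<open>young_pointwise\<close>) bounds by \<open>1 - 2 / p\<close> times the left-hand integrand and
  \<open>2 / p\<close> times the right-hand one with its constant. Integration over a compact interval without zeros therefore gives
  the inequality with an error, \<open>p / 2\<close> times the increment of the boundary term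
  (\<open>excess_le_nonzero\<close>).

  The point is to pass through the zeros of \<open>f\<close>, at which \<open>f'\<close> vanishes too but \<open>H\<close> may tend to \<open>-\<infinity>\<close>.
  If the right-hand side is finite, then on each side of a zero the boundary term still has the
  favourable sign, up to an arbitrarily small error, at points arbitrarily close to the zero
  (\<open>boundary_term_small_left_of_zero\<close>). Hence each component of the nonzero set
  between two zeros satisfies the inequality without error. There are countably many such
  components, so \<open>excess_le_compact\<close> holds on every compact interval: only the two endpoints
  contribute. Exhausting \<open>(a, b)\<close> along points at which the boundary condition makes the increment
  small yields the claim.
\<close>

section \<open>Absolutely continuous functions\<close>

lemma abs_cont_on_imp_continuous_on:
  assumes F: "abs_cont_on {c..d} F"
  shows "continuous_on {c..d} F"
  unfolding continuous_on_iff
proof (intro ballI allI impI)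
  fix x e :: real assume x: "x \<in> {c..d}" and e: "e > 0"
  then obtain \<delta> where \<delta>: "\<delta> > 0"
    and AC: "\<And>\<D> T. \<D> division_of T \<Longrightarrow> T \<subseteq> {c..d} \<Longrightarrow> (\<Sum>k\<in>\<D>. Sup k - Inf k) < \<delta>
              \<Longrightarrow> (\<Sum>k\<in>\<D>. \<bar>F (Sup k) - F (Inf k)\<bar>) < e"
    using F unfolding abs_cont_on_def by metis
  have small: "\<bar>F v - F u\<bar> < e" if "u \<in> {c..d}" "v \<in> {c..d}" "u \<le> v" "v - u < \<delta>" for u v
    using AC[of "{{u..v}}" "{u..v}"] division_of_self[of u v] that by auto
  show "\<exists>\<delta>>0. \<forall>y\<in>{c..d}. dist y x < \<delta> \<longrightarrow> dist (F y) (F x) < e"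
  proof (intro exI[of _ \<delta>] conjI ballI impI \<delta>)
    fix y assume "y \<in> {c..d}" "dist y x < \<delta>"
    then show "dist (F y) (F x) < e"
      using small[of x y] small[of y x] x by (cases "x \<le> y") (auto simp: dist_real_def)
  qed
qed

text \<open>
  The fundamental theorem of calculus for absolutely continuous functions, as a Henstock integral.
  Where the derivative exists, the gauge comes from the straddle estimate. The exceptional null
  set is covered by an open set of small measure, so the intervals tagged there have small
  total length, and absolute continuity bounds the total increment over them.
\<close>
lemma abs_cont_on_has_integral:
  assumes "c \<le> d" and F: "abs_cont_on {c..d} F"
    and ae: "AE x in lebesgue. x \<in> {c..d} \<longrightarrow> (F has_real_derivative g x) (at x)"
  shows "(g has_integral (F d - F c)) {c..d}"
proof -
  define N where "N = {x \<in> {c..d}. \<not> (F has_real_derivative g x) (at x)}"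
  have "N \<in> null_sets lebesgue"
    using ae unfolding completion.AE_iff_null_sets N_def
    by (rule back_subst[of "\<lambda>A. A \<in> null_sets lebesgue"]) auto
  then have N: "negligible N"
    using negligible_iff_null_sets by blast
  define g0 where "g0 x = (if x \<in> N then 0 else g x)" for x
  have "(g0 has_integral (F d - F c)) {c..d}"
    unfolding has_integral_real
  proof (intro allI impI)
    fix e :: real assume e: "e > 0"
    define e1 where "e1 = e / (2 * (d - c + 1))"
    have e1: "e1 > 0" "e1 * (d - c) < e / 2"
    proof -
      show "e1 > 0" using e \<open>c \<le> d\<close> by (simp add: e1_def)
      show "e1 * (d - c) < e / 2"
        using e \<open>c \<le> d\<close> by (simp add: e1_def field_simps)
    qed
    obtain \<delta> where \<delta>: "\<delta> > 0"
      and AC: "\<And>\<D> T. \<D> division_of T \<Longrightarrow> T \<subseteq> {c..d} \<Longrightarrow> (\<Sum>k\<in>\<D>. Sup k - Inf k) < \<delta>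
                \<Longrightarrow> (\<Sum>k\<in>\<D>. \<bar>F (Sup k) - F (Inf k)\<bar>) < e / 2"
      using F e unfolding abs_cont_on_def by (metis half_gt_zero)
    obtain U where U: "open U" "N \<subseteq> U" "U - N \<in> lmeasurable" "emeasure lebesgue (U - N) < ennreal \<delta>"
      using sets_lebesgue_outer_open \<delta> negligible_imp_sets[OF N] by metis
    have Um: "U \<in> lmeasurable" "measure lebesgue U < \<delta>"
    proof -
      have Nm: "N \<in> lmeasurable" "measure lebesgue N = 0"
        using N negligible_iff_measure by blast+
      have *: "U = (U - N) \<union> N" using U by auto
      show "U \<in> lmeasurable"
        by (subst *) (intro fmeasurable.Un U Nm)
      have "measure lebesgue U \<le> measure lebesgue (U - N) + measure lebesgue N"
        by (subst *) (intro measure_Un_le fmeasurableD U Nm)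
      also have "\<dots> < \<delta>"
        using U(4) \<delta> by (simp add: Nm emeasure_eq_measure2[OF U(3)] ennreal_less_iff)
      finally show "measure lebesgue U < \<delta>" .
    qed
    have "\<exists>r>0. if x \<in> N then ball x r \<subseteq> U else
        (x \<in> {c..d} \<longrightarrow> (\<forall>y. \<bar>y - x\<bar> < r \<longrightarrow> \<bar>F y - F x - g x * (y - x)\<bar> \<le> e1 * \<bar>y - x\<bar>))" for x
    proof (cases "x \<in> N")
      case True
      then show ?thesis using U open_contains_ball by (auto simp: subset_iff)
    next
      case False
      show ?thesis
      proof (cases "x \<in> {c..d}")
        case True
        with False have "(F has_derivative (\<lambda>y. g x * y)) (at x)"
          by (auto simp: N_def has_field_derivative_def)
        then show ?thesis
          using e1(1) False unfolding has_derivative_at_alt by (auto simp: True)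
      next
        case False then show ?thesis using \<open>x \<notin> N\<close> by (auto intro: exI[of _ 1])
      qed
    qed
    then obtain r where r: "\<And>x. r x > 0"
      "\<And>x. x \<in> N \<Longrightarrow> ball x (r x) \<subseteq> U"
      "\<And>x y. x \<notin> N \<Longrightarrow> x \<in> {c..d} \<Longrightarrow> \<bar>y - x\<bar> < r x \<Longrightarrow> \<bar>F y - F x - g x * (y - x)\<bar> \<le> e1 * \<bar>y - x\<bar>"
      by metis
    show "\<exists>\<gamma>. gauge \<gamma> \<and> (\<forall>\<D>. \<D> tagged_division_of {c..d} \<and> \<gamma> fine \<D> \<longrightarrow>
            norm ((\<Sum>(x,k)\<in>\<D>. measure lborel k *\<^sub>R g0 x) - (F d - F c)) < e)"
    proof (intro exI[of _ "\<lambda>x. ball x (r x)"] conjI allI impI)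
      show "gauge (\<lambda>x. ball x (r x))"
        using r(1) by (simp add: gauge_ball_dependent)
      fix p assume "p tagged_division_of {c..d} \<and> (\<lambda>x. ball x (r x)) fine p"
      then have p: "p tagged_division_of {c..d}" and fine: "(\<lambda>x. ball x (r x)) fine p" by auto
      have fin: "finite p" using p by auto
      have pK: "\<exists>u v. K = {u..v} \<and> u \<le> v \<and> c \<le> u \<and> v \<le> d \<and> x \<in> {u..v} \<and> K \<subseteq> ball x (r x)
          \<and> Inf K = u \<and> Sup K = v \<and> measure lborel K = v - u"
        if xK: "(x, K) \<in> p" for x K
      proof -
        obtain u v where "K = {u..v}" using p xK by (metis tagged_division_ofD(4) box_real(2))
        moreover have "x \<in> K" "K \<subseteq> {c..d}" using p xK by auto
        moreover have "K \<subseteq> ball x (r x)" using fine xK by (auto simp: fine_def)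
        ultimately show ?thesis by (intro exI[of _ u] exI[of _ v]) auto
      qed
      have tele: "d - c = (\<Sum>(x,K)\<in>p. Sup K - Inf K)" "F d - F c = (\<Sum>(x,K)\<in>p. F (Sup K) - F (Inf K))"
        using additive_tagged_division_1[where f= "\<lambda>x. x"] additive_tagged_division_1[where f= F]
              \<open>c \<le> d\<close> p by auto
      define pN where "pN = {t\<in>p. fst t \<in> N}"
      have "pN tagged_partial_division_of {c..d}"
        using tagged_partial_division_subset[of p "{c..d}" pN] p
        by (auto simp: tagged_division_of_def pN_def)
      then have pN_tag: "pN tagged_division_of \<Union>(snd ` pN)"
        and pN_div: "(snd ` pN) division_of \<Union>(snd ` pN)"
        by (auto simp: tagged_division_of_def tagged_partial_division_of_def
            intro!: partial_division_of_tagged_division; blast)+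
      have pNK: "K \<subseteq> {c..d} \<and> K \<subseteq> U \<and> Sup K - Inf K = measure lebesgue K" if K: "K \<in> snd ` pN" for K
      proof -
        obtain x where x: "(x, K) \<in> p" "x \<in> N" using K by (auto simp: pN_def)
        obtain u v where "K = {u..v}" "u \<le> v" "c \<le> u" "v \<le> d" "K \<subseteq> ball x (r x)"
          using pK[OF x(1)] by blast
        then show ?thesis using r(2)[OF x(2)] by auto
      qed
      then have sub: "\<Union>(snd ` pN) \<subseteq> {c..d}" "\<Union>(snd ` pN) \<subseteq> U" by blast+
      have "(\<Sum>k\<in>snd ` pN. Sup k - Inf k) = (\<Sum>k\<in>snd ` pN. measure lebesgue k)"
        using pNK by (intro sum.cong) simp_all
      also have "\<dots> = measure lebesgue (\<Union>(snd ` pN))"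
        using content_division[OF pN_div] .
      also have "\<dots> \<le> measure lebesgue U"
        by (intro measure_mono_fmeasurable sub Um fmeasurableD lmeasurable_division[OF pN_div])
      also have "\<dots> < \<delta>" by (rule Um)
      finally have "(\<Sum>k\<in>snd ` pN. \<bar>F (Sup k) - F (Inf k)\<bar>) < e / 2"
        using AC[OF pN_div sub(1)] by blast
      moreover have "(\<Sum>(x,k)\<in>pN. \<bar>F (Sup k) - F (Inf k)\<bar>) = (\<Sum>k\<in>snd ` pN. \<bar>F (Sup k) - F (Inf k)\<bar>)"
      proof -
        \<comment> \<open>\<open>Sup {}\<close> and \<open>Inf {}\<close> are unspecified reals, so the empty interval is set to zero.\<close>
        define \<Delta> where "\<Delta> k = (if k = {} then 0 else \<bar>F (Sup k) - F (Inf k)\<bar>)" for k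
        have ne: "k \<noteq> {}" if "k \<in> snd ` pN" for k
          using pN_div that by auto
        have "(\<Sum>(x,k)\<in>pN. \<bar>F (Sup k) - F (Inf k)\<bar>) = (\<Sum>(x,k)\<in>pN. \<Delta> k)"
          using ne by (intro sum.cong refl) (force simp: \<Delta>_def split: prod.splits)
        also have "\<dots> = (\<Sum>k\<in>snd ` pN. \<Delta> k)"
        proof (rule sum.over_tagged_division_lemma[OF pN_tag])
          fix u v :: real assume "box u v = {}"
          then show "\<Delta> (cbox u v) = 0"
            by (cases "u = v") (auto simp: box_real \<Delta>_def)
        qed
        also have "\<dots> = (\<Sum>k\<in>snd ` pN. \<bar>F (Sup k) - F (Inf k)\<bar>)"
          using ne by (intro sum.cong) (auto simp: \<Delta>_def)
        finally show ?thesis .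
      qed
      ultimately have 1: "(\<Sum>(x,k)\<in>pN. \<bar>F (Sup k) - F (Inf k)\<bar>) < e / 2" by simp
      have 2: "(\<Sum>(x,k)\<in>p - pN. \<bar>measure lborel k * g x - (F (Sup k) - F (Inf k))\<bar>) \<le> e1 * (d - c)"
      proof -
        have "(\<Sum>(x,k)\<in>p - pN. \<bar>measure lborel k * g x - (F (Sup k) - F (Inf k))\<bar>)
              \<le> (\<Sum>(x,k)\<in>p - pN. e1 * (Sup k - Inf k))"
        proof (rule sum_mono, clarify)
          fix x K assume xK: "(x, K) \<in> p" "(x, K) \<notin> pN"
          then obtain u v where K: "K = {u..v}" "u \<le> v" "c \<le> u" "v \<le> d" "x \<in> {u..v}" "K \<subseteq> ball x (r x)"
            "Inf K = u" "Sup K = v" "measure lborel K = v - u"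
            using pK by metis
          have x: "x \<notin> N" "x \<in> {c..d}" using xK K by (auto simp: pN_def)
          have "u \<in> K" "v \<in> K" using K by auto
          then have "u \<in> ball x (r x)" "v \<in> ball x (r x)" using K(6) by blast+
          then have "\<bar>F u - F x - g x * (u - x)\<bar> \<le> e1 * (x - u)" "\<bar>F v - F x - g x * (v - x)\<bar> \<le> e1 * (v - x)"
            using r(3)[OF x, of u] r(3)[OF x, of v] K by (auto simp: dist_real_def abs_minus_commute)
          then have "\<bar>(v - u) * g x - (F v - F u)\<bar> \<le> e1 * (v - u)"
            by (simp add: algebra_simps)
          then show "\<bar>measure lborel K * g x - (F (Sup K) - F (Inf K))\<bar> \<le> e1 * (Sup K - Inf K)"
            by (simp only: K(7-9))
        qed
        also have "\<dots> \<le> (\<Sum>(x,k)\<in>p. e1 * (Sup k - Inf k))"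
        proof (rule sum_mono2[OF fin])
          show "0 \<le> (case b of (x, k) \<Rightarrow> e1 * (Sup k - Inf k))" if "b \<in> p - (p - pN)" for b
            using pK[of "fst b" "snd b"] that e1(1) by (auto split: prod.splits)
        qed auto
        also have "\<dots> = e1 * (d - c)"
          unfolding tele by (simp add: sum_distrib_left split_def)
        finally show ?thesis .
      qed
      have split: "p = pN \<union> (p - pN)" "pN \<inter> (p - pN) = {}" "finite pN"
        using fin by (auto simp: pN_def)
      have "(\<Sum>(x,k)\<in>p. measure lborel k *\<^sub>R g0 x) - (F d - F c)
          = (\<Sum>(x,k)\<in>p. measure lborel k * g0 x - (F (Sup k) - F (Inf k)))"
        unfolding tele by (simp add: sum_subtractf split_def)
      also have "\<bar>\<dots>\<bar> \<le> (\<Sum>(x,k)\<in>p. \<bar>measure lborel k * g0 x - (F (Sup k) - F (Inf k))\<bar>)"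
        by (rule order_trans[OF sum_abs]) (simp add: split_def)
      also have "\<dots> = (\<Sum>(x,k)\<in>pN. \<bar>measure lborel k * g0 x - (F (Sup k) - F (Inf k))\<bar>)
          + (\<Sum>(x,k)\<in>p - pN. \<bar>measure lborel k * g0 x - (F (Sup k) - F (Inf k))\<bar>)"
        using split fin by (metis (no_types, lifting) finite_Diff sum.union_disjoint)
      also have "(\<Sum>(x,k)\<in>pN. \<bar>measure lborel k * g0 x - (F (Sup k) - F (Inf k))\<bar>)
          = (\<Sum>(x,k)\<in>pN. \<bar>F (Sup k) - F (Inf k)\<bar>)"
        by (rule sum.cong) (auto simp: pN_def g0_def)
      also have "(\<Sum>(x,k)\<in>p - pN. \<bar>measure lborel k * g0 x - (F (Sup k) - F (Inf k))\<bar>)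
          = (\<Sum>(x,k)\<in>p - pN. \<bar>measure lborel k * g x - (F (Sup k) - F (Inf k))\<bar>)"
        by (rule sum.cong) (auto simp: pN_def g0_def)
      finally show "norm ((\<Sum>(x,k)\<in>p. measure lborel k *\<^sub>R g0 x) - (F d - F c)) < e"
        using 1 2 e1 by simp
    qed
  qed
  then show ?thesis
    by (rule has_integral_spike[OF N, rotated]) (auto simp: g0_def)
qed

lemma abs_cont_on_compose_Lipschitz:
  assumes F: "abs_cont_on S F" and L: "\<And>x y. x \<in> S \<Longrightarrow> y \<in> S \<Longrightarrow> \<bar>\<phi> (F y) - \<phi> (F x)\<bar> \<le> L * \<bar>F y - F x\<bar>"
  shows "abs_cont_on S (\<lambda>x. \<phi> (F x))"
  unfolding abs_cont_on_def
proof (intro allI impI)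
  fix e :: real assume "e > 0"
  define L' where "L' = \<bar>L\<bar> + 1"
  have L': "L' > 0" by (simp add: L'_def)
  obtain \<delta> where \<delta>: "\<delta> > 0" and AC: "\<And>\<D> T. \<D> division_of T \<and> T \<subseteq> S \<and> (\<Sum>k\<in>\<D>. Sup k - Inf k) < \<delta>
          \<Longrightarrow> (\<Sum>k\<in>\<D>. \<bar>F (Sup k) - F (Inf k)\<bar>) < e / L'"
    using F \<open>e > 0\<close> L' unfolding abs_cont_on_def by (metis divide_pos_pos)
  show "\<exists>\<delta>>0. \<forall>\<D> T. \<D> division_of T \<and> T \<subseteq> S \<and> (\<Sum>k\<in>\<D>. Sup k - Inf k) < \<delta>
          \<longrightarrow> (\<Sum>k\<in>\<D>. \<bar>\<phi> (F (Sup k)) - \<phi> (F (Inf k))\<bar>) < e"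
  proof (intro exI[of _ \<delta>] conjI \<delta> allI impI)
    fix \<D> T assume D: "\<D> division_of T \<and> T \<subseteq> S \<and> (\<Sum>k\<in>\<D>. Sup k - Inf k) < \<delta>"
    have "(\<Sum>k\<in>\<D>. \<bar>\<phi> (F (Sup k)) - \<phi> (F (Inf k))\<bar>) \<le> (\<Sum>k\<in>\<D>. L' * \<bar>F (Sup k) - F (Inf k)\<bar>)"
    proof (rule sum_mono)
      fix K assume "K \<in> \<D>"
      then obtain u v where "K = {u..v}" "u \<le> v" "K \<subseteq> S"
        using D by (metis atLeastatMost_empty_iff box_real(2) cbox_division_memE order_trans)
      then have "Inf K \<in> S" "Sup K \<in> S" by auto
      then have "\<bar>\<phi> (F (Sup K)) - \<phi> (F (Inf K))\<bar> \<le> L * \<bar>F (Sup K) - F (Inf K)\<bar>"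
        using L by blast
      also have "\<dots> \<le> L' * \<bar>F (Sup K) - F (Inf K)\<bar>"
        by (intro mult_right_mono) (auto simp: L'_def)
      finally show "\<bar>\<phi> (F (Sup K)) - \<phi> (F (Inf K))\<bar> \<le> L' * \<bar>F (Sup K) - F (Inf K)\<bar>" .
    qed
    also have "\<dots> = L' * (\<Sum>k\<in>\<D>. \<bar>F (Sup k) - F (Inf k)\<bar>)" by (simp add: sum_distrib_left)
    also have "\<dots> < e" using AC[OF D] L' by (simp add: field_simps)
    finally show "(\<Sum>k\<in>\<D>. \<bar>\<phi> (F (Sup k)) - \<phi> (F (Inf k))\<bar>) < e" .
  qed
qed

text \<open>Absolute continuity of any quantity whose increments are controlled by those of two others.\<close>
lemma abs_cont_on_dominated:
  assumes F: "abs_cont_on S F" and K: "abs_cont_on S K"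
    and le: "\<And>x y. x \<in> S \<Longrightarrow> y \<in> S \<Longrightarrow> \<bar>G y - G x\<bar> \<le> B * \<bar>F y - F x\<bar> + C * \<bar>K y - K x\<bar>"
  shows "abs_cont_on S G"
  unfolding abs_cont_on_def
proof (intro allI impI)
  fix e :: real assume "e > 0"
  define M where "M = \<bar>B\<bar> + \<bar>C\<bar> + 1"
  have M: "M > 0" "B \<le> M" "C \<le> M" by (auto simp: M_def)
  have e': "e / (2 * M) > 0" using \<open>e > 0\<close> M by simp
  obtain \<delta>1 where \<delta>1: "\<delta>1 > 0" and AC1: "\<And>\<D> T. \<D> division_of T \<and> T \<subseteq> S \<and> (\<Sum>k\<in>\<D>. Sup k - Inf k) < \<delta>1
          \<Longrightarrow> (\<Sum>k\<in>\<D>. \<bar>F (Sup k) - F (Inf k)\<bar>) < e / (2 * M)"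
    using F e' unfolding abs_cont_on_def by metis
  obtain \<delta>2 where \<delta>2: "\<delta>2 > 0" and AC2: "\<And>\<D> T. \<D> division_of T \<and> T \<subseteq> S \<and> (\<Sum>k\<in>\<D>. Sup k - Inf k) < \<delta>2
          \<Longrightarrow> (\<Sum>k\<in>\<D>. \<bar>K (Sup k) - K (Inf k)\<bar>) < e / (2 * M)"
    using K e' unfolding abs_cont_on_def by metis
  show "\<exists>\<delta>>0. \<forall>\<D> T. \<D> division_of T \<and> T \<subseteq> S \<and> (\<Sum>k\<in>\<D>. Sup k - Inf k) < \<delta>
          \<longrightarrow> (\<Sum>k\<in>\<D>. \<bar>G (Sup k) - G (Inf k)\<bar>) < e"
  proof (intro exI[of _ "min \<delta>1 \<delta>2"] conjI allI impI)
    fix \<D> T assume D: "\<D> division_of T \<and> T \<subseteq> S \<and> (\<Sum>k\<in>\<D>. Sup k - Inf k) < min \<delta>1 \<delta>2"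
    have "(\<Sum>k\<in>\<D>. \<bar>G (Sup k) - G (Inf k)\<bar>)
        \<le> (\<Sum>k\<in>\<D>. M * \<bar>F (Sup k) - F (Inf k)\<bar> + M * \<bar>K (Sup k) - K (Inf k)\<bar>)"
    proof (rule sum_mono)
      fix k assume "k \<in> \<D>"
      then obtain u v where "k = {u..v}" "u \<le> v" "k \<subseteq> S"
        using D by (metis atLeastatMost_empty_iff box_real(2) cbox_division_memE order_trans)
      then have "Inf k \<in> S" "Sup k \<in> S" by auto
      then have "\<bar>G (Sup k) - G (Inf k)\<bar> \<le> B * \<bar>F (Sup k) - F (Inf k)\<bar> + C * \<bar>K (Sup k) - K (Inf k)\<bar>"
        using le by blast
      also have "\<dots> \<le> M * \<bar>F (Sup k) - F (Inf k)\<bar> + M * \<bar>K (Sup k) - K (Inf k)\<bar>"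
        by (intro add_mono mult_right_mono M) auto
      finally show "\<bar>G (Sup k) - G (Inf k)\<bar> \<le> M * \<bar>F (Sup k) - F (Inf k)\<bar> + M * \<bar>K (Sup k) - K (Inf k)\<bar>" .
    qed
    also have "\<dots> = M * (\<Sum>k\<in>\<D>. \<bar>F (Sup k) - F (Inf k)\<bar>) + M * (\<Sum>k\<in>\<D>. \<bar>K (Sup k) - K (Inf k)\<bar>)"
      by (simp add: sum.distrib sum_distrib_left)
    also have "\<dots> < M * (e / (2 * M)) + M * (e / (2 * M))"
      using D by (intro add_strict_mono mult_strict_left_mono AC1[of \<D> T] AC2[of \<D> T] M) auto
    also have "\<dots> = e" using M by simp
    finally show "(\<Sum>k\<in>\<D>. \<bar>G (Sup k) - G (Inf k)\<bar>) < e" .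
  qed (use \<delta>1 \<delta>2 in auto)
qed

lemma abs_cont_on_add:
  assumes "abs_cont_on S F" "abs_cont_on S K"
  shows "abs_cont_on S (\<lambda>x. F x + K x)"
  by (rule abs_cont_on_dominated[OF assms, of _ 1 1]) auto

lemma abs_cont_on_mult:
  assumes F: "abs_cont_on {c..d} F" and K: "abs_cont_on {c..d} K"
  shows "abs_cont_on {c..d} (\<lambda>x. F x * K x)"
proof -
  have "bounded (F ` {c..d})" "bounded (K ` {c..d})"
    by (intro compact_imp_bounded compact_continuous_image abs_cont_on_imp_continuous_on F K compact_Icc)+
  then obtain B C where B: "\<And>x. x \<in> {c..d} \<Longrightarrow> \<bar>F x\<bar> \<le> B" and C: "\<And>x. x \<in> {c..d} \<Longrightarrow> \<bar>K x\<bar> \<le> C"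
    unfolding bounded_real by (metis imageI)
  show ?thesis
  proof (rule abs_cont_on_dominated[OF F K, of _ C B])
    fix x y assume "x \<in> {c..d}" "y \<in> {c..d}"
    have "F y * K y - F x * K x = (F y - F x) * K y + F x * (K y - K x)" by (simp add: algebra_simps)
    also have "\<bar>\<dots>\<bar> \<le> \<bar>F y - F x\<bar> * \<bar>K y\<bar> + \<bar>F x\<bar> * \<bar>K y - K x\<bar>"
      by (metis abs_mult abs_triangle_ineq)
    also have "\<dots> \<le> \<bar>F y - F x\<bar> * C + B * \<bar>K y - K x\<bar>"
      by (intro add_mono mult_left_mono mult_right_mono B C \<open>x \<in> _\<close> \<open>y \<in> _\<close>) auto
    finally show "\<bar>F y * K y - F x * K x\<bar> \<le> C * \<bar>F y - F x\<bar> + B * \<bar>K y - K x\<bar>"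
      by (simp add: mult.commute)
  qed
qed

lemma abs_cont_on_ident: "abs_cont_on {c..d} (\<lambda>x. x)"
  unfolding abs_cont_on_def
proof (intro allI impI)
  fix e :: real assume "e > 0"
  show "\<exists>\<delta>>0. \<forall>\<D> T. \<D> division_of T \<and> T \<subseteq> {c..d} \<and> (\<Sum>k\<in>\<D>. Sup k - Inf k) < \<delta>
          \<longrightarrow> (\<Sum>k\<in>\<D>. \<bar>Sup k - Inf k\<bar>) < e"
  proof (intro exI[of _ e] conjI \<open>e > 0\<close> allI impI)
    fix \<D> T assume D: "\<D> division_of T \<and> T \<subseteq> {c..d} \<and> (\<Sum>k\<in>\<D>. Sup k - Inf k) < e"
    have "(\<Sum>k\<in>\<D>. \<bar>Sup k - Inf k\<bar>) = (\<Sum>k\<in>\<D>. Sup k - Inf k)"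
    proof (rule sum.cong)
      fix k assume "k \<in> \<D>"
      then obtain u v where "k = {u..v}" "u \<le> v"
        using D by (metis atLeastatMost_empty_iff box_real(2) cbox_division_memE)
      then show "\<bar>Sup k - Inf k\<bar> = Sup k - Inf k" by auto
    qed simp
    then show "(\<Sum>k\<in>\<D>. \<bar>Sup k - Inf k\<bar>) < e" using D by simp
  qed
qed

lemma abs_cont_on_compose_C1:
  assumes F: "abs_cont_on {c..d} F"
    and FV: "F ` {c..d} \<subseteq> V"
    and D: "\<And>y. y \<in> V \<Longrightarrow> (\<phi> has_real_derivative \<phi>' y) (at y)"
    and C: "continuous_on V \<phi>'"
  shows "abs_cont_on {c..d} (\<lambda>x. \<phi> (F x))"
proof (cases "c \<le> d")
  case True
  have cont: "continuous_on {c..d} F" by (rule abs_cont_on_imp_continuous_on[OF F])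
  obtain m M where mM: "m \<le> M" "F ` {c..d} = {m..M}"
    using continuous_image_closed_interval[OF True cont] by auto
  have sub: "{m..M} \<subseteq> V" using FV mM by simp
  have "bounded (\<phi>' ` {m..M})"
    by (intro compact_imp_bounded compact_continuous_image continuous_on_subset[OF C sub] compact_Icc)
  then obtain L where L: "\<And>y. y \<in> {m..M} \<Longrightarrow> \<bar>\<phi>' y\<bar> \<le> L"
    unfolding bounded_real by (metis imageI)
  show ?thesis
  proof (rule abs_cont_on_compose_Lipschitz[OF F])
    fix x y assume "x \<in> {c..d}" "y \<in> {c..d}"
    then have "F x \<in> {m..M}" "F y \<in> {m..M}" using mM by blast+
    then have "norm (\<phi> (F y) - \<phi> (F x)) \<le> L * norm (F y - F x)"
      using sub L has_field_derivative_at_within[OF D]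
      by (intro field_differentiable_bound[where S = "{m..M}" and f' = \<phi>']) auto
    then show "\<bar>\<phi> (F y) - \<phi> (F x)\<bar> \<le> L * \<bar>F y - F x\<bar>" by simp
  qed
next
  case False
  then show ?thesis
    by (auto simp: abs_cont_on_def intro!: exI[of _ 1])
qed

lemma abs_cont_on_C1:
  assumes "{c..d} \<subseteq> V"
    and "\<And>y. y \<in> V \<Longrightarrow> (\<phi> has_real_derivative \<phi>' y) (at y)" "continuous_on V \<phi>'"
  shows "abs_cont_on {c..d} \<phi>"
  using abs_cont_on_compose_C1[OF abs_cont_on_ident, of c d V \<phi> \<phi>'] assms by simp

lemma loc_abs_cont_on_reflect:
  assumes "loc_abs_cont_on S F"
  shows "loc_abs_cont_on (uminus ` S) (\<lambda>x. F (- x))"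
  unfolding loc_abs_cont_on_def
proof (intro allI impI)
  fix c d :: real assume cd: "c \<le> d" "{c..d} \<subseteq> uminus ` S"
  have "uminus ` {c..d} \<subseteq> uminus ` (uminus ` S)" by (rule image_mono[OF cd(2)])
  then have "{-d..-c} \<subseteq> S" by (simp add: image_image)
  then have F: "abs_cont_on {-d..-c} F" using assms cd by (simp add: loc_abs_cont_on_def)
  show "abs_cont_on {c..d} (\<lambda>x. F (- x))"
    unfolding abs_cont_on_def
  proof (intro allI impI)
    fix e :: real assume "e > 0"
    then obtain \<delta> where \<delta>: "\<delta> > 0"
      and AC: "\<And>\<D> T. \<D> division_of T \<and> T \<subseteq> {-d..-c} \<and> (\<Sum>k\<in>\<D>. Sup k - Inf k) < \<delta>
          \<Longrightarrow> (\<Sum>k\<in>\<D>. \<bar>F (Sup k) - F (Inf k)\<bar>) < e"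
      using F unfolding abs_cont_on_def by metis
    show "\<exists>\<delta>>0. \<forall>\<D> T. \<D> division_of T \<and> T \<subseteq> {c..d} \<and> (\<Sum>k\<in>\<D>. Sup k - Inf k) < \<delta>
          \<longrightarrow> (\<Sum>k\<in>\<D>. \<bar>F (- Sup k) - F (- Inf k)\<bar>) < e"
    proof (intro exI[of _ \<delta>] conjI \<delta> allI impI)
      fix \<D> T assume D: "\<D> division_of T \<and> T \<subseteq> {c..d} \<and> (\<Sum>k\<in>\<D>. Sup k - Inf k) < \<delta>"
      let ?r = "\<lambda>K. uminus ` K :: real set"
      have inj: "inj_on ?r \<D>"
        by (meson inj_image_eq_iff inj_onI inj_uminus)
      have div: "?r ` \<D> division_of ?r T"
      proof (rule division_ofI)
        show "finite (?r ` \<D>)" using D by auto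
        show "\<Union> (?r ` \<D>) = ?r T" using D by (auto simp: division_of_def)
        fix K assume "K \<in> ?r ` \<D>"
        then obtain L where L: "L \<in> \<D>" "K = ?r L" by auto
        show "K \<subseteq> ?r T" "K \<noteq> {}" using L D by auto
        obtain u v where "L = {u..v}" using D L by (metis box_real(2) cbox_division_memE)
        then show "\<exists>a b. K = cbox a b" using L by auto
        fix K' assume "K' \<in> ?r ` \<D>" "K \<noteq> K'"
        then obtain L' where L': "L' \<in> \<D>" "K' = ?r L'" "L \<noteq> L'" using L by auto
        then have "interior L \<inter> interior L' = {}" using D L by auto
        then show "interior K \<inter> interior K' = {}"
          by (auto simp: L L' interior_negations)
      qed
      have ends: "Sup (?r k) = - Inf k \<and> Inf (?r k) = - Sup k" if "k \<in> \<D>" for k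
      proof -
        obtain u v where "k = {u..v}" "u \<le> v"
          using D \<open>k \<in> \<D>\<close> by (metis atLeastatMost_empty_iff box_real(2) cbox_division_memE)
        then show ?thesis by auto
      qed
      have "(\<Sum>k\<in>?r ` \<D>. Sup k - Inf k) = (\<Sum>k\<in>\<D>. Sup k - Inf k)"
        unfolding sum.reindex[OF inj] using ends by (intro sum.cong) auto
      moreover have "?r T \<subseteq> {-d..-c}" using D by auto
      ultimately have "(\<Sum>k\<in>?r ` \<D>. \<bar>F (Sup k) - F (Inf k)\<bar>) < e"
        using AC[of "?r ` \<D>" "?r T"] div D by auto
      also have "(\<Sum>k\<in>?r ` \<D>. \<bar>F (Sup k) - F (Inf k)\<bar>) = (\<Sum>k\<in>\<D>. \<bar>F (- Sup k) - F (- Inf k)\<bar>)"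
        unfolding sum.reindex[OF inj] using ends by (intro sum.cong) (auto simp: abs_minus_commute)
      finally show "(\<Sum>k\<in>\<D>. \<bar>F (- Sup k) - F (- Inf k)\<bar>) < e" .
    qed
  qed
qed

lemma AE_lebesgue_reflect:
  assumes "AE x in lebesgue. P (x::real)"
  shows "AE x in lebesgue. P (- x)"
proof -
  obtain N where N: "N \<in> null_sets lebesgue" "\<And>x. x \<notin> N \<Longrightarrow> P x"
    using assms unfolding completion.AE_iff_null_sets by auto
  have "negligible (uminus ` N)"
    using N by (intro negligible_differentiable_image_negligible)
      (auto simp: negligible_iff_null_sets intro!: derivative_intros)
  then have "uminus ` N \<in> null_sets lebesgue" by (simp add: negligible_iff_null_sets)
  moreover have "P (- x)" if "x \<notin> uminus ` N" for x
    using N(2)[of "- x"] that by force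
  ultimately show ?thesis
    by (intro AE_I'[of "uminus ` N"]) auto
qed

text \<open>
  An integrated differential inequality \<open>X \<le> Y + F'\<close>. The derivative of \<open>F\<close> is only Henstock
  integrable a priori; adding the integrable \<open>Y\<close> makes it nonnegative, hence Lebesgue integrable.
\<close>
lemma abs_cont_on_nn_integral_le:
  fixes X Y g :: "real \<Rightarrow> real"
  assumes "c \<le> d" and F: "abs_cont_on {c..d} F"
    and ae: "AE x in lebesgue. x \<in> {c..d} \<longrightarrow> (F has_real_derivative g x) (at x)"
    and X: "\<And>x. 0 \<le> X x"
    and Y: "\<And>x. 0 \<le> Y x" "Y \<in> borel_measurable lebesgue"
    and le: "AE x in lebesgue. x \<in> {c..d} \<longrightarrow> X x \<le> Y x + g x"
    and fin: "(\<integral>\<^sup>+x\<in>{c..d}. ennreal (Y x) \<partial>lebesgue) < \<infinity>"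
  shows "(\<integral>\<^sup>+x\<in>{c..d}. ennreal (X x) \<partial>lebesgue)
      \<le> ennreal (enn2real (\<integral>\<^sup>+x\<in>{c..d}. ennreal (Y x) \<partial>lebesgue) + (F d - F c))"
    and "0 \<le> enn2real (\<integral>\<^sup>+x\<in>{c..d}. ennreal (Y x) \<partial>lebesgue) + (F d - F c)"
proof -
  let ?I = "\<lambda>x. indicator {c..d} x :: real"
  define y where "y = enn2real (\<integral>\<^sup>+x\<in>{c..d}. ennreal (Y x) \<partial>lebesgue)"
  have [measurable]: "Y \<in> borel_measurable lebesgue" by fact
  have eqY: "(\<integral>\<^sup>+x\<in>{c..d}. ennreal (Y x) \<partial>lebesgue) = (\<integral>\<^sup>+x. ennreal (?I x * Y x) \<partial>lebesgue)"
    by (intro nn_integral_cong) (auto simp: indicator_def)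
  have mY: "(\<lambda>x. ?I x * Y x) \<in> borel_measurable lebesgue"
    by (intro borel_measurable_times borel_measurable_indicator Y) simp
  have "((\<lambda>x. ?I x * Y x) has_integral y) UNIV"
    using fin Y(1) mY by (subst has_integral_iff_nn_integral_lebesgue) (auto simp: y_def eqY)
  then have "(Y has_integral y) {c..d}"
    by (subst has_integral_restrict_UNIV[symmetric])
       (auto simp: indicator_def if_distrib cong: if_cong elim!: has_integral_eq_rhs
          intro: has_integral_eq[rotated])
  from has_integral_add[OF this abs_cont_on_has_integral[OF \<open>c \<le> d\<close> F ae]]
  have "((\<lambda>x. if x \<in> {c..d} then Y x + g x else 0) has_integral (y + (F d - F c))) UNIV"
    by (subst has_integral_restrict_UNIV)
  then have "((\<lambda>x. ?I x * max 0 (Y x + g x)) has_integral (y + (F d - F c))) UNIV"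
  proof (rule has_integral_spike[rotated 2])
    let ?N = "{x. \<not> (x \<in> {c..d} \<longrightarrow> X x \<le> Y x + g x)}"
    show "negligible ?N"
      using le by (simp add: negligible_iff_null_sets completion.AE_iff_null_sets)
    show "?I x * max 0 (Y x + g x) = (if x \<in> {c..d} then Y x + g x else 0)" if "x \<in> UNIV - ?N" for x
      using that X[of x] by (auto simp: indicator_def)
  qed
  then have S: "(\<integral>\<^sup>+x. ennreal (?I x * max 0 (Y x + g x)) \<partial>lebesgue) = ennreal (y + (F d - F c))"
    and "0 \<le> y + (F d - F c)"
    by (subst (asm) has_integral_iff_nn_integral_lebesgue; auto)+
  then show "0 \<le> enn2real (\<integral>\<^sup>+x\<in>{c..d}. ennreal (Y x) \<partial>lebesgue) + (F d - F c)"
    by (simp add: y_def)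
  have "(\<integral>\<^sup>+x\<in>{c..d}. ennreal (X x) \<partial>lebesgue)
      \<le> (\<integral>\<^sup>+x. ennreal (?I x * max 0 (Y x + g x)) \<partial>lebesgue)"
    using le by (intro nn_integral_mono_AE) (auto elim!: eventually_mono simp: indicator_def ennreal_leI)
  then show "(\<integral>\<^sup>+x\<in>{c..d}. ennreal (X x) \<partial>lebesgue)
      \<le> ennreal (enn2real (\<integral>\<^sup>+x\<in>{c..d}. ennreal (Y x) \<partial>lebesgue) + (F d - F c))"
    by (simp add: S y_def)
qed

section \<open>Comparison of two measures with a defect\<close>

text \<open>
  The mass that \<open>M\<close> gives to \<open>S\<close> exceeds that of \<open>N\<close> by at most \<open>e\<close>, which may be negative.
  Nothing is claimed where \<open>N\<close> is infinite.
\<close>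
definition excess_le :: "'a measure \<Rightarrow> 'a measure \<Rightarrow> 'a set \<Rightarrow> real \<Rightarrow> bool" where
  "excess_le M N S e \<longleftrightarrow>
     (emeasure N S < \<infinity> \<longrightarrow> emeasure M S < \<infinity> \<and> measure M S \<le> measure N S + e)"

lemma excess_le_emeasure:
  assumes "excess_le M N S e" "e \<le> \<epsilon>" "0 \<le> \<epsilon>"
  shows "emeasure M S \<le> emeasure N S + ennreal \<epsilon>"
proof (cases "emeasure N S < \<infinity>")
  case True
  then have "emeasure M S < \<infinity>" "measure M S \<le> measure N S + \<epsilon>"
    using assms by (auto simp: excess_le_def)
  then have "ennreal (measure M S) \<le> ennreal (measure N S) + ennreal \<epsilon>"
    using assms by (simp flip: ennreal_plus)
  then show ?thesis
    using True \<open>emeasure M S < \<infinity>\<close> by (simp add: emeasure_eq_ennreal_measure)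
next
  case False
  then show ?thesis by (simp add: not_less top_unique)
qed

lemma excess_le_mono: "excess_le M N S d \<Longrightarrow> d \<le> e \<Longrightarrow> excess_le M N S e"
  by (auto simp: excess_le_def)

lemma excess_leI_emeasure:
  assumes "emeasure M S \<le> emeasure N S"
  shows "excess_le M N S 0"
  using assms enn2real_mono[OF assms] by (auto simp: excess_le_def measure_def)

lemma excess_le_Un:
  assumes "excess_le M N S d" "excess_le M N T e"
    and "S \<in> sets M" "T \<in> sets M" "sets N = sets M" "S \<inter> T = {}"
  shows "excess_le M N (S \<union> T) (d + e)"
  unfolding excess_le_def
proof
  assume fin: "emeasure N (S \<union> T) < \<infinity>"
  have "emeasure N S \<le> emeasure N (S \<union> T)" "emeasure N T \<le> emeasure N (S \<union> T)"
    using assms by (auto intro!: emeasure_mono)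
  then have N: "emeasure N S < \<infinity>" "emeasure N T < \<infinity>" using fin by auto
  then have M: "emeasure M S < \<infinity>" "emeasure M T < \<infinity>"
    "measure M S \<le> measure N S + d" "measure M T \<le> measure N T + e"
    using assms by (auto simp: excess_le_def)
  have "emeasure M (S \<union> T) = emeasure M S + emeasure M T"
    using assms by (intro plus_emeasure[symmetric]) auto
  moreover have "measure M (S \<union> T) = measure M S + measure M T"
    using assms N M by (intro measure_Un2[THEN trans] measure_Union) auto
  moreover have "measure N (S \<union> T) = measure N S + measure N T"
    using assms N M by (intro measure_Union) auto
  ultimately show "emeasure M (S \<union> T) < \<infinity> \<and> measure M (S \<union> T) \<le> measure N (S \<union> T) + (d + e)"
    using M by simp
qed

text \<open>The defect need only be controlled at points \<open>t\<close> arbitrarily close to the right end.\<close>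
lemma excess_le_limit_right:
  fixes M N :: "real measure"
  assumes "r < z" and sets: "sets M = sets lebesgue" "sets N = sets lebesgue"
    and lim: "\<And>\<epsilon> t0. emeasure N {r..<z} < \<infinity> \<Longrightarrow> 0 < \<epsilon> \<Longrightarrow> r \<le> t0 \<Longrightarrow> t0 < z \<Longrightarrow>
                \<exists>t. t0 < t \<and> t < z \<and> excess_le M N {r..t} (e + \<epsilon>)"
  shows "excess_le M N {r..<z} e"
  unfolding excess_le_def
proof
  assume fin: "emeasure N {r..<z} < \<infinity>"
  have bnd: "emeasure M {r..t0} < \<infinity> \<and> measure M {r..t0} \<le> measure N {r..<z} + e + \<epsilon>"
    if t0: "0 < \<epsilon>" "r \<le> t0" "t0 < z" for t0 \<epsilon>
  proof -
    obtain t where t: "t0 < t" "t < z" "excess_le M N {r..t} (e + \<epsilon>)"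
      using lim[OF fin t0] by auto
    have "emeasure N {r..t} \<le> emeasure N {r..<z}"
      using t by (intro emeasure_mono) (auto simp: sets)
    then have Nt: "emeasure N {r..t} < \<infinity>" "measure N {r..t} \<le> measure N {r..<z}"
      using fin by (auto simp: measure_def intro!: enn2real_mono)
    then have Mt: "emeasure M {r..t} < \<infinity>" "measure M {r..t} \<le> measure N {r..t} + (e + \<epsilon>)"
      using t(3) by (auto simp: excess_le_def)
    have le: "emeasure M {r..t0} \<le> emeasure M {r..t}"
      using t by (intro emeasure_mono) (auto simp: sets)
    then have "emeasure M {r..t0} < \<infinity>" "measure M {r..t0} \<le> measure M {r..t}"
      using Mt(1) by (auto simp: measure_def intro!: enn2real_mono)
    then show ?thesis using Mt Nt by auto
  qed
  have bnd': "emeasure M {r..t0} \<le> ennreal (measure N {r..<z} + e)" if "r \<le> t0" "t0 < z" for t0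
  proof -
    have "measure M {r..t0} \<le> measure N {r..<z} + e"
      by (rule field_le_epsilon) (use bnd[OF _ that] in blast)
    then show ?thesis
      using conjunct1[OF bnd[OF zero_less_one that]] by (simp add: emeasure_eq_ennreal_measure ennreal_leI)
  qed
  have pos: "0 \<le> measure N {r..<z} + e"
  proof (rule field_le_epsilon)
    fix \<epsilon> :: real assume "0 < \<epsilon>"
    show "0 \<le> measure N {r..<z} + e + \<epsilon>"
      using bnd[OF \<open>0 < \<epsilon>\<close> order_refl \<open>r < z\<close>] measure_nonneg[of M "{r..r}"] by linarith
  qed
  define A where "A n = {r..z - (z - r) / real (Suc n)}" for n
  have inc: "incseq A"
  proof (rule incseq_SucI)
    fix n
    have "(z - r) / real (Suc (Suc n)) \<le> (z - r) / real (Suc n)"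
      using \<open>r < z\<close> by (intro divide_left_mono) auto
    then show "A n \<le> A (Suc n)" by (auto simp: A_def)
  qed
  have "(\<Union>n. A n) = {r..<z}"
  proof (intro equalityI subsetI)
    fix x assume "x \<in> (\<Union>n. A n)"
    then obtain n where "r \<le> x" "x \<le> z - (z - r) / real (Suc n)" by (auto simp: A_def)
    moreover have "(z - r) / real (Suc n) > 0" using \<open>r < z\<close> by simp
    ultimately show "x \<in> {r..<z}" by auto
  next
    fix x assume x: "x \<in> {r..<z}"
    then obtain n where "(z - r) / (z - x) < real (Suc n)"
      by (meson less_Suc_eq_le reals_Archimedean2 lessI of_nat_less_iff order_less_trans)
    then have "(z - r) / real (Suc n) < z - x" using x by (simp add: field_simps)
    then show "x \<in> (\<Union>n. A n)" using x by (auto simp: A_def intro!: exI[of _ n])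
  qed
  then have "emeasure M {r..<z} = (SUP n. emeasure M (A n))"
    using SUP_emeasure_incseq[OF _ inc, of M] by (simp add: sets A_def image_subset_iff)
  also have "\<dots> \<le> ennreal (measure N {r..<z} + e)"
    unfolding A_def using \<open>r < z\<close>
    by (intro SUP_least bnd') (auto simp: field_simps intro: mult_right_mono)
  finally have le: "emeasure M {r..<z} \<le> ennreal (measure N {r..<z} + e)" .
  then show "emeasure M {r..<z} < \<infinity> \<and> measure M {r..<z} \<le> measure N {r..<z} + e"
    using enn2real_mono[OF le] pos by (auto simp: measure_def intro: le_less_trans)
qed

lemma ex_small_left_tail:
  fixes N :: "real measure"
  assumes sets: "sets N = sets lebesgue" and fin: "emeasure N {r..<z} < \<infinity>"
    and "r < z" "r \<le> t0" "t0 < z" "0 < \<delta>"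
  shows "\<exists>x. t0 < x \<and> x < z \<and> measure N {x..<z} < \<delta>"
proof -
  define A where "A n = {z - (z - r) / real (Suc n)..<z}" for n
  have sub: "A n \<subseteq> {r..<z}" for n
  proof -
    have "(z - r) / real (Suc n) \<le> (z - r) / 1"
      using \<open>r < z\<close> by (intro divide_left_mono) auto
    then show ?thesis by (auto simp: A_def)
  qed
  have fm: "A n \<in> fmeasurable N" for n
  proof (rule fmeasurableI2[OF _ sub])
    show "{r..<z} \<in> fmeasurable N" using fin by (auto simp: fmeasurable_def sets)
    show "A n \<in> sets N" by (auto simp: A_def sets)
  qed
  have dec: "decseq A"
  proof (rule decseq_SucI)
    fix n
    have "(z - r) / real (Suc (Suc n)) \<le> (z - r) / real (Suc n)"
      using \<open>r < z\<close> by (intro divide_left_mono) auto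
    then show "A (Suc n) \<subseteq> A n" by (auto simp: A_def)
  qed
  have lim0: "(\<lambda>n. (z - r) * (1 / real (Suc n))) \<longlonglongrightarrow> (z - r) * 0"
    by (intro tendsto_mult tendsto_const LIMSEQ_Suc[OF lim_1_over_n])
  have "(\<Inter>n. A n) = {}"
  proof -
    have False if x: "\<And>n. x \<in> A n" for x
    proof -
      have "x < z" using x[of 0] by (simp add: A_def)
      have "\<forall>\<^sub>F n in sequentially. (z - r) * (1 / real (Suc n)) < z - x"
        using order_tendstoD(2)[OF lim0, of "z - x"] \<open>x < z\<close> by simp
      then obtain n where "(z - r) * (1 / real (Suc n)) < z - x"
        using eventually_happens by fastforce
      then show False using x[of n] by (simp add: A_def)
    qed
    then show ?thesis by blast
  qed
  then have "(\<lambda>n. measure N (A n)) \<longlonglongrightarrow> 0"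
    using Lim_measure_decseq[OF _ dec, of N] fm by (simp add: fmeasurable_def image_subset_iff less_top)
  then have "\<forall>\<^sub>F n in sequentially. measure N (A n) < \<delta>"
    using order_tendstoD(2) \<open>0 < \<delta>\<close> by blast
  moreover have "\<forall>\<^sub>F n in sequentially. (z - r) * (1 / real (Suc n)) < z - t0"
    using order_tendstoD(2)[OF lim0, of "z - t0"] \<open>t0 < z\<close> by simp
  ultimately have "\<forall>\<^sub>F n in sequentially. measure N (A n) < \<delta> \<and> (z - r) * (1 / real (Suc n)) < z - t0"
    by (rule eventually_conj)
  then obtain n where n: "measure N (A n) < \<delta>" "(z - r) * (1 / real (Suc n)) < z - t0"
    using eventually_happens by fastforce
  moreover have "(z - r) / real (Suc n) > 0" using \<open>r < z\<close> by simp
  ultimately show ?thesis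
    by (intro exI[of _ "z - (z - r) / real (Suc n)"]) (auto simp: A_def)
qed

lemma emeasure_le_components:
  fixes M N :: "real measure"
  assumes "open U" and sets: "sets M = sets lebesgue" "sets N = sets lebesgue"
    and le: "\<And>C. C \<in> components U \<Longrightarrow> emeasure M C \<le> emeasure N C"
  shows "emeasure M U \<le> emeasure N U"
proof -
  have op: "open C" if "C \<in> components U" for C using open_components[OF \<open>open U\<close> that] .
  have count: "countable (components U)"
    using pairwise_disjoint_components[of U] op
    by (intro countable_disjoint_open_subsets) (auto simp: pairwise_def disjnt_def)
  have disj: "disjoint_family_on (\<lambda>C. C) (components U)"
    using pairwise_disjoint_components[of U] by (auto simp: pairwise_def disjoint_family_on_def)
  have m: "C \<in> sets M" "C \<in> sets N" if "C \<in> components U" for C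
    using op[OF that] by (auto simp: sets)
  have eq: "(\<Union>((\<lambda>C. C) ` components U)) = U" by simp
  have "emeasure M U = (\<integral>\<^sup>+C. emeasure M C \<partial>count_space (components U))"
    using emeasure_UN_countable[OF m(1) count disj] by (simp add: eq)
  also have "\<dots> \<le> (\<integral>\<^sup>+C. emeasure N C \<partial>count_space (components U))"
    by (intro nn_integral_mono) (auto simp: le)
  also have "\<dots> = emeasure N U"
    using emeasure_UN_countable[OF m(2) count disj] by (simp add: eq)
  finally show ?thesis .
qed

lemma open_interval_components:
  assumes "open U" "U \<subseteq> {l..u::real}" "C \<in> components U"
  obtains \<alpha> \<beta> where "\<alpha> < \<beta>" "C = {\<alpha><..<\<beta>}" "\<alpha> \<in> {l..u} - U" "\<beta> \<in> {l..u} - U"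
proof -
  have C: "open C" "connected C" "C \<noteq> {}" "C \<subseteq> U"
    using open_components[OF assms(1,3)] assms(3)
      in_components_connected in_components_nonempty in_components_subset by metis+
  have bdd: "bdd_below C" "bdd_above C"
    using subset_trans[OF C(4) assms(2)]
    by (auto intro: bdd_below_mono[of "{l..u}"] bdd_above_mono[of "{l..u}"])
  define \<alpha> \<beta> where "\<alpha> = Inf C" "\<beta> = Sup C"
  have CI: "C = {\<alpha><..<\<beta>}"
  proof (intro equalityI subsetI)
    fix x assume x: "x \<in> C"
    then obtain e where e: "e > 0" "ball x e \<subseteq> C" using C open_contains_ball by blast
    then have "x - e/2 \<in> C" "x + e/2 \<in> C" by (auto simp: subset_iff dist_real_def)
    then have "\<alpha> \<le> x - e/2" "x + e/2 \<le> \<beta>" using bdd by (auto simp: \<alpha>_\<beta>_def intro: cInf_lower cSup_upper)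
    then show "x \<in> {\<alpha><..<\<beta>}" using e by auto
  next
    fix x assume x: "x \<in> {\<alpha><..<\<beta>}"
    then obtain y z where "y \<in> C" "y < x" "z \<in> C" "x < z"
      using C(3) bdd by (auto simp: \<alpha>_\<beta>_def cInf_less_iff less_cSup_iff)
    then show "x \<in> C" using C(2) by (meson connectedD_interval less_imp_le)
  qed
  then have lt: "\<alpha> < \<beta>" using C(3) by auto
  have fr: "frontier C \<subseteq> {l..u} - U"
  proof -
    have "frontier C \<subseteq> frontier U" by (rule frontier_of_components_subset[OF assms(3)])
    also have "\<dots> \<subseteq> {l..u} - U"
      using assms closure_minimal[of U "{l..u}"] by (auto simp: frontier_def interior_open)
    finally show ?thesis .
  qed
  have "frontier C = {\<alpha>, \<beta>}"
    using lt by (auto simp: CI frontier_def)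
  then show ?thesis using that[OF lt CI] fr by auto
qed

section \<open>Pointwise inequalities\<close>

text \<open>For \<open>p = 2\<close> the case distinction is needed at \<open>y = 0\<close>, where \<open>0 powr 0 = 0\<close>.\<close>
lemma has_real_derivative_signed_power:
  fixes p :: real
  assumes "p \<ge> 2"
  shows "((\<lambda>y. \<bar>y\<bar> powr (p - 2) * y) has_real_derivative
            (p - 1) * (if p = 2 then 1 else \<bar>y\<bar> powr (p - 2))) (at y)"
proof (cases "p = 2")
  case True
  have "(\<lambda>y::real. \<bar>y\<bar> powr (p - 2) * y) = (\<lambda>y. y)" using True by auto
  then show ?thesis using True by simp
next
  case False
  with assms have p: "p > 2" by simp
  consider "y > 0" | "y < 0" | "y = 0" by linarith
  then show ?thesis
  proof cases
    case 1
    have pw: "y powr (p - 2 - 1) * y = y powr (p - 2)"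
      using powr_add[of y "p - 2 - 1" 1] 1 by simp
    have "((\<lambda>y. y powr (p - 2) * y) has_real_derivative (p - 1) * y powr (p - 2)) (at y)"
      by (rule DERIV_cong[OF DERIV_mult[OF has_real_derivative_powr[OF 1] DERIV_ident]])
         (use pw in \<open>simp add: left_diff_distrib mult.assoc\<close>)
    then have "((\<lambda>y. \<bar>y\<bar> powr (p - 2) * y) has_real_derivative (p - 1) * y powr (p - 2)) (at y)"
      by (rule DERIV_cong_ev[THEN iffD1, OF refl _ refl, rotated])
         (use 1 in \<open>auto intro: eventually_mono[OF eventually_nhds_in_open[of "{0<..}"]]\<close>)
    then show ?thesis using 1 False by simp
  next
    case 2
    have pw: "(- y) powr (p - 2 - 1) * y = - ((- y) powr (p - 2))"
      using powr_add[of "- y" "p - 2 - 1" 1] 2 by simp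
    have "((\<lambda>y. (- y) powr (p - 2) * y) has_real_derivative (p - 1) * (- y) powr (p - 2)) (at y)"
      by (rule DERIV_cong[OF DERIV_mult[OF DERIV_fun_powr[OF DERIV_minus[OF DERIV_ident]] DERIV_ident]])
         (use 2 pw in \<open>simp_all add: left_diff_distrib mult.assoc\<close>)
    then have "((\<lambda>y. \<bar>y\<bar> powr (p - 2) * y) has_real_derivative (p - 1) * (- y) powr (p - 2)) (at y)"
      by (rule DERIV_cong_ev[THEN iffD1, OF refl _ refl, rotated])
         (use 2 in \<open>auto intro: eventually_mono[OF eventually_nhds_in_open[of "{..<0}"]]\<close>)
    then show ?thesis using 2 False by simp
  next
    case 3
    have "isCont (\<lambda>h::real. \<bar>h\<bar> powr (p - 2)) 0"
      using p by (intro continuous_on_interior[of UNIV] continuous_on_powr' continuous_intros) auto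
    then have "(\<lambda>h. \<bar>h\<bar> powr (p - 2)) \<midarrow>0\<rightarrow> 0"
      using p by (simp add: isCont_def)
    then have "(\<lambda>h. (\<bar>0 + h\<bar> powr (p - 2) * (0 + h) - \<bar>0\<bar> powr (p - 2) * 0) / h) \<midarrow>0\<rightarrow> 0"
      by (rule Lim_transform_eventually) (auto simp: eventually_at intro!: exI[of _ 1])
    then show ?thesis using 3 False p by (simp add: DERIV_def)
  qed
qed

lemma continuous_on_signed_power_deriv:
  fixes p :: real
  assumes "p \<ge> 2"
  shows "continuous_on UNIV (\<lambda>y::real. (p - 1) * (if p = 2 then 1 else \<bar>y\<bar> powr (p - 2)))"
  using assms by (cases "p = 2") (auto intro!: continuous_intros continuous_on_powr')

text \<open>
  Young's inequality with exponents \<open>p / (p - 2)\<close> and \<open>p / 2\<close>. For \<open>v = f'\<close>, \<open>z = f''\<close>, and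
  with \<open>K\<close> and \<open>h\<close> the values of \<open>H\<close> and \<open>h\<close> at \<open>f > 0\<close>, the right-hand side is the derivative of
  \<open>\<bar>f'\<bar> powr (p - 2) * f' * H f\<close>.
\<close>
lemma young_pointwise:
  fixes p v z K h :: real
  assumes p: "p \<ge> 2" and h: "h > 0"
  shows "2 / p * (\<bar>v\<bar> powr p * h - (p - 1) powr (p / 2) * (\<bar>z * (K / h)\<bar> powr (p / 2) * h))
    \<le> (p - 1) * (if p = 2 then 1 else \<bar>v\<bar> powr (p - 2)) * z * K + \<bar>v\<bar> powr p * h"
proof -
  let ?s = "if p = 2 then 1 else \<bar>v\<bar> powr (p - 2)"
  define X where "X = \<bar>v\<bar> powr p * h"
  define Y where "Y = (p - 1) powr (p / 2) * (\<bar>z * (K / h)\<bar> powr (p / 2) * h)"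
  have XY: "X \<ge> 0" "Y \<ge> 0" using h by (auto simp: X_def Y_def)
  have key: "(p - 1) * ?s * \<bar>z * K\<bar> \<le> (1 - 2 / p) * X + 2 / p * Y"
  proof (cases "p = 2 \<or> v = 0 \<or> z * K = 0")
    case True
    then show ?thesis
    proof (elim disjE)
      assume "p = 2"
      then show ?thesis using h by (simp add: Y_def abs_mult)
    next
      assume "v = 0"
      then show ?thesis using h p XY by (cases "p = 2") (auto simp: Y_def abs_mult)
    next
      assume "z * K = 0"
      then show ?thesis using p XY by (simp only: abs_zero mult_zero_right) (auto intro!: add_nonneg_nonneg)
    qed
  next
    case False
    then have nz: "p > 2" "\<bar>v\<bar> > 0" "\<bar>z * K\<bar> > 0" using p by auto
    then have XY': "X > 0" "Y > 0" using h by (auto simp: X_def Y_def)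
    have "X powr (1 - 2 / p) = \<bar>v\<bar> powr (p - 2) * h powr (1 - 2 / p)"
      using nz h by (simp add: X_def powr_mult powr_powr right_diff_distrib)
    moreover have "Y powr (2 / p) = (p - 1) * (\<bar>z * K\<bar> / h) * h powr (2 / p)"
      using nz h by (simp add: Y_def powr_mult powr_powr abs_mult abs_divide)
    ultimately have "X powr (1 - 2 / p) * Y powr (2 / p) = (p - 1) * \<bar>v\<bar> powr (p - 2) * \<bar>z * K\<bar>"
      using h by (simp add: powr_diff)
    then show ?thesis
      using Youngs_inequality_0[of "1 - 2 / p" "2 / p" X Y] XY' nz by simp
  qed
  have "- ((p - 1) * ?s * \<bar>z * K\<bar>) \<le> (p - 1) * ?s * z * K"
    using p mult_left_mono[of "- \<bar>z * K\<bar>" "z * K" "(p - 1) * ?s"]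
    by (simp add: mult.assoc)
  moreover have "(1 - 2 / p) * X = X - 2 / p * X" "2 / p * (X - Y) = 2 / p * X - 2 / p * Y"
    by (simp_all only: left_diff_distrib right_diff_distrib mult_1)
  ultimately have "2 / p * (X - Y) \<le> (p - 1) * ?s * z * K + X"
    using key by linarith
  then show ?thesis by (simp only: X_def Y_def)
qed

text \<open>
  Here \<open>k * v powr (k - 1) * \<bar>z\<bar>\<close> is the size of the derivative of \<open>v powr k\<close> when \<open>v = - f'\<close> and
  \<open>z = f''\<close>. The first term on the right is, up to a constant factor, the derivative of
  \<open>L powr (- 2 / p)\<close> with \<open>L = - H f\<close>, and the last factor is the right-hand integrand. The
  inequality is the alternative \<open>A \<le> B\<close> or \<open>A \<le> A powr (p / 2) * B powr (1 - p / 2)\<close>, in which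
  the powers of \<open>v\<close> cancel.
\<close>
lemma power_decay_pointwise:
  fixes p v L h \<eta> z :: real
  assumes p: "p \<ge> 2" and pos: "v > 0" "L > 0" "h > 0" "\<eta> > 0"
  defines "k \<equiv> 2 * (p - 1) / p"
  shows "k * v powr (k - 1) * \<bar>z\<bar>
    \<le> \<eta> * L powr (- 2 / p - 1) * (h * v)
      + (2 / p) powr (p / 2) * \<eta> powr (1 - p / 2) * L powr (- 2 / p)
        * ((p - 1) powr (p / 2) * (\<bar>z * (L / h)\<bar> powr (p / 2) * h))"
    (is "?a \<le> ?b + ?c")
proof (cases "?a \<le> ?b")
  case True
  moreover have "?c \<ge> 0" using pos p by (intro mult_nonneg_nonneg) auto
  ultimately show ?thesis by linarith
next
  case False
  have b: "?b > 0" using pos by simp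
  have a: "?a > 0" using False b by linarith
  have k: "k > 0" "k - 1 = (p - 2) / p" using p by (auto simp: k_def field_simps)
  have z: "\<bar>z\<bar> > 0" using a by (cases "z = 0") auto
  have "?a = ?a powr (p / 2) * ?a powr (1 - p / 2)"
    using a by (simp flip: powr_add)
  also have "\<dots> \<le> ?a powr (p / 2) * ?b powr (1 - p / 2)"
    using False b p by (intro mult_left_mono powr_mono2') auto
  also have "?a powr (p / 2) = k powr (p / 2) * v powr (p / 2 - 1) * \<bar>z\<bar> powr (p / 2)"
  proof -
    have "(k - 1) * (p / 2) = p / 2 - 1" using p unfolding k(2) by (simp add: field_simps)
    then show ?thesis using k(1) pos by (simp add: powr_mult powr_powr diff_divide_distrib)
  qed
  also have "?b powr (1 - p / 2) = \<eta> powr (1 - p / 2) * L powr (p / 2 - 2 / p) * h powr (1 - p / 2) * v powr (1 - p / 2)"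
  proof -
    have "(- 2 / p - 1) * (1 - p / 2) = p / 2 - 2 / p"
      using p by (simp add: field_simps)
    then show ?thesis using pos by (simp add: powr_mult powr_powr)
  qed
  also have "k powr (p / 2) = (2 / p) powr (p / 2) * (p - 1) powr (p / 2)"
    using p by (simp add: k_def powr_mult[symmetric])
  also have "(2 / p) powr (p / 2) * (p - 1) powr (p / 2) * v powr (p / 2 - 1) * \<bar>z\<bar> powr (p / 2)
      * (\<eta> powr (1 - p / 2) * L powr (p / 2 - 2 / p) * h powr (1 - p / 2) * v powr (1 - p / 2))
    = (2 / p) powr (p / 2) * \<eta> powr (1 - p / 2) * (p - 1) powr (p / 2)
      * (\<bar>z\<bar> powr (p / 2) * L powr (p / 2 - 2 / p) * h powr (1 - p / 2)) * (v powr (p / 2 - 1) * v powr (1 - p / 2))"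
    by (simp add: ac_simps)
  also have "v powr (p / 2 - 1) * v powr (1 - p / 2) = 1"
    using pos by (simp flip: powr_add)
  also have "\<bar>z\<bar> powr (p / 2) * L powr (p / 2 - 2 / p) * h powr (1 - p / 2)
      = L powr (- 2 / p) * (\<bar>z * (L / h)\<bar> powr (p / 2) * h)"
    using pos z by (simp add: abs_mult powr_mult powr_divide powr_diff powr_minus_divide)
  finally have "?a \<le> ?c" by (simp add: ac_simps)
  then show ?thesis using b by linarith
qed

lemma borel_measurable_derivative_indicator:
  fixes F g :: "real \<Rightarrow> real"
  assumes "open E" and F: "continuous_on E F"
    and ae: "AE x in lebesgue. x \<in> E \<longrightarrow> (F has_real_derivative g x) (at x)"
  shows "(\<lambda>x. indicator E x * g x) \<in> borel_measurable lebesgue"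
proof -
  define FE where "FE x = indicator E x * F x" for x
  define q where "q n x = (FE (x + 1 / real (Suc n)) - FE x) * real (Suc n)" for n x
  have FE[measurable]: "FE \<in> borel_measurable borel"
    using borel_measurable_continuous_on_indicator[of E F] assms by (simp add: FE_def[abs_def])
  have [measurable]: "q n \<in> borel_measurable borel" for n
    unfolding q_def[abs_def] by measurable
  have [measurable]: "E \<in> sets borel" using \<open>open E\<close> by simp
  have "(\<lambda>x. indicator E x * lim (\<lambda>n. q n x)) \<in> borel_measurable borel" by measurable
  then have m: "(\<lambda>x. indicator E x * lim (\<lambda>n. q n x)) \<in> borel_measurable lebesgue"
    by (intro measurable_completion) simp
  have lim: "lim (\<lambda>n. q n x) = g x" if x: "x \<in> E" "(F has_real_derivative g x) (at x)" for x
  proof (rule limI)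
    have "filterlim (\<lambda>n. 1 / real (Suc n)) (at 0) sequentially"
      unfolding filterlim_at using LIMSEQ_Suc[OF lim_1_over_n] by auto
    moreover have "(\<lambda>h. (F (x + h) - F x) / h) \<midarrow>0\<rightarrow> g x" using x by (simp add: DERIV_def)
    ultimately have "(\<lambda>n. (F (x + 1 / real (Suc n)) - F x) / (1 / real (Suc n))) \<longlonglongrightarrow> g x"
      by (rule filterlim_compose[rotated])
    moreover have "(\<lambda>n. x + 1 / real (Suc n)) \<longlonglongrightarrow> x + 0"
      by (intro tendsto_add tendsto_const LIMSEQ_Suc[OF lim_1_over_n])
    then have "\<forall>\<^sub>F n in sequentially. x + 1 / real (Suc n) \<in> E"
      using \<open>open E\<close> x by (intro topological_tendstoD) auto
    ultimately show "(\<lambda>n. q n x) \<longlonglongrightarrow> g x"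
      by (elim Lim_transform_eventually) (auto elim!: eventually_mono simp: q_def FE_def x)
  qed
  show ?thesis
    by (rule borel_measurable_AE[OF m]) (use ae in \<open>auto elim!: eventually_mono simp: indicator_def lim\<close>)
qed

section \<open>The inequality away from the zeros\<close>

text \<open>
  The standing data on an open interval \<open>E\<close>. The functions \<open>f1\<close> and \<open>f2\<close> are the first and
  the second derivative of \<open>f\<close>; having them as parameters makes the setting stable under
  \<open>f \<mapsto> - f\<close> and under reflection of the line.
\<close>
locale no_single_zero_setting =
  fixes p :: real and h H :: "real \<Rightarrow> real" and E :: "real set" and f f1 f2 :: "real \<Rightarrow> real"
  assumes p: "p \<ge> 2"
    and open_E: "open E" and interval_E: "is_interval E"
    and h_cont: "continuous_on {0<..} h" and h_pos: "\<And>t. t > 0 \<Longrightarrow> h t > 0"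
    and H_deriv: "\<And>t. t > 0 \<Longrightarrow> (H has_real_derivative h t) (at t)"
    and f_deriv: "\<And>x. x \<in> E \<Longrightarrow> (f has_real_derivative f1 x) (at x)"
    and f1_ac: "loc_abs_cont_on E f1"
    and f2_ae: "is_ae_deriv_on E f1 f2"
    and zeros: "\<And>x. x \<in> E \<Longrightarrow> f x = 0 \<Longrightarrow> f1 x = 0"
begin

text \<open>The two integrands, extended by zero, the right-hand one with its constant.\<close>
definition X :: "real \<Rightarrow> real" where
  "X x = indicator {x \<in> E. f x \<noteq> 0} x * (\<bar>f1 x\<bar> powr p * h \<bar>f x\<bar>)"

definition Y :: "real \<Rightarrow> real" where
  "Y x = indicator {x \<in> E. f x \<noteq> 0} x *
      ((p - 1) powr (p / 2) * (\<bar>f2 x * (H \<bar>f x\<bar> / h \<bar>f x\<bar>)\<bar> powr (p / 2) * h \<bar>f x\<bar>))"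

text \<open>
  The boundary term, with the factor \<open>p / 2\<close> that Young's inequality produces. It vanishes where
  \<open>f\<close> does, because of the sign factor, whatever the value of \<open>H\<close> at \<open>0\<close>.
\<close>
definition G :: "real \<Rightarrow> real" where
  "G x = p / 2 * (\<bar>f1 x\<bar> powr (p - 2) * f1 x * sgn (f x) * H \<bar>f x\<bar>)"

text \<open>The measures with densities \<open>X\<close> and \<open>Y\<close>, both concentrated on the nonzero set of \<open>f\<close> in \<open>E\<close>.\<close>
definition MX :: "real measure" where "MX = density lebesgue (\<lambda>x. ennreal (X x))"
definition MY :: "real measure" where "MY = density lebesgue (\<lambda>x. ennreal (Y x))"

lemma sets_MX [simp]: "sets MX = sets lebesgue" and sets_MY [simp]: "sets MY = sets lebesgue"
  by (simp_all add: MX_def MY_def)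

lemma f_cont: "continuous_on E f"
  using f_deriv by (intro DERIV_continuous_on) (blast intro: has_field_derivative_at_within)

lemma f1_cont: "continuous_on E f1"
proof (rule continuous_at_imp_continuous_on, rule ballI)
  fix x assume "x \<in> E"
  then obtain e where e: "e > 0" "cball x e \<subseteq> E"
    using open_E open_contains_cball by blast
  then have "{x-e..x+e} \<subseteq> E" by (simp add: cball_eq_atLeastAtMost)
  then have "continuous_on {x-e..x+e} f1"
    using e f1_ac by (intro abs_cont_on_imp_continuous_on) (auto simp: loc_abs_cont_on_def)
  then show "isCont f1 x"
    using e by (intro continuous_on_interior[of "{x-e..x+e}"]) auto
qed

lemma H_cont: "continuous_on {0<..} H"
  using H_deriv by (intro DERIV_continuous_on) (auto intro: has_field_derivative_at_within)

lemma H_mono: "0 < s \<Longrightarrow> s \<le> t \<Longrightarrow> H s \<le> H t"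
  by (rule DERIV_nonneg_imp_nondecreasing)
     (meson H_deriv h_pos less_imp_le order_less_le_trans)+

lemma Icc_subset_E: "c \<in> E \<Longrightarrow> d \<in> E \<Longrightarrow> {c..d} \<subseteq> E"
  using interval_E unfolding is_interval_1 by (meson atLeastAtMost_iff subsetI)

lemma open_nonzero: "open {x \<in> E. f x \<noteq> 0}"
proof -
  have "{x \<in> E. f x \<noteq> 0} = f -` (- {0}) \<inter> E" by auto
  then show ?thesis
    using continuous_on_open_vimage[OF open_E] f_cont by (metis open_Compl closed_singleton)
qed

lemma cont_h_abs: "continuous_on {x \<in> E. f x \<noteq> 0} (\<lambda>x. h \<bar>f x\<bar>)"
  and cont_H_abs: "continuous_on {x \<in> E. f x \<noteq> 0} (\<lambda>x. H \<bar>f x\<bar>)"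
proof -
  have "continuous_on {x \<in> E. f x \<noteq> 0} (\<lambda>x. \<bar>f x\<bar>)"
    by (intro continuous_intros continuous_on_subset[OF f_cont]) auto
  then show "continuous_on {x \<in> E. f x \<noteq> 0} (\<lambda>x. h \<bar>f x\<bar>)"
    "continuous_on {x \<in> E. f x \<noteq> 0} (\<lambda>x. H \<bar>f x\<bar>)"
    by (auto intro: continuous_on_compose2[OF h_cont] continuous_on_compose2[OF H_cont])
qed

lemma X_nonneg: "0 \<le> X x" and Y_nonneg: "0 \<le> Y x"
  using h_pos[of "\<bar>f x\<bar>"] by (auto simp: X_def Y_def indicator_def)

lemma indicator_cont_measurable:
  assumes "continuous_on {x \<in> E. f x \<noteq> 0} \<phi>"
  shows "(\<lambda>x. indicator {x \<in> E. f x \<noteq> 0} x * (\<phi> x :: real)) \<in> borel_measurable lebesgue"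
proof -
  have "(\<lambda>x. indicator {x \<in> E. f x \<noteq> 0} x *\<^sub>R \<phi> x) \<in> borel_measurable borel"
    using open_nonzero assms by (intro borel_measurable_continuous_on_indicator) auto
  then show ?thesis
    by (intro measurable_completion) simp
qed

lemma X_measurable [measurable]: "X \<in> borel_measurable lebesgue"
  unfolding X_def[abs_def] using p
  by (intro indicator_cont_measurable continuous_intros cont_h_abs continuous_on_powr'
      continuous_on_subset[OF f1_cont]) auto

lemma Y_measurable [measurable]: "Y \<in> borel_measurable lebesgue"
proof -
  let ?I = "indicator {x \<in> E. f x \<noteq> 0} :: real \<Rightarrow> real"
  have [measurable]: "(\<lambda>x. indicator E x * f2 x) \<in> borel_measurable lebesgue"
    using f2_ae by (intro borel_measurable_derivative_indicator[OF open_E f1_cont]) (simp add: is_ae_deriv_on_def)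
  have [measurable]: "(\<lambda>x. ?I x * h \<bar>f x\<bar>) \<in> borel_measurable lebesgue"
    "(\<lambda>x. ?I x * (H \<bar>f x\<bar> / h \<bar>f x\<bar>)) \<in> borel_measurable lebesgue"
  proof -
    have "h \<bar>f x\<bar> \<noteq> 0" if "f x \<noteq> 0" for x using h_pos[of "\<bar>f x\<bar>"] that by auto
    then show "(\<lambda>x. ?I x * h \<bar>f x\<bar>) \<in> borel_measurable lebesgue"
      "(\<lambda>x. ?I x * (H \<bar>f x\<bar> / h \<bar>f x\<bar>)) \<in> borel_measurable lebesgue"
      by (intro indicator_cont_measurable continuous_intros cont_h_abs cont_H_abs; auto)+
  qed
  have "(\<lambda>x. (p - 1) powr (p / 2) * (\<bar>(indicator E x * f2 x) * (?I x * (H \<bar>f x\<bar> / h \<bar>f x\<bar>))\<bar> powr (p / 2)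
      * (?I x * h \<bar>f x\<bar>))) \<in> borel_measurable lebesgue"
    by measurable
  also have "(\<lambda>x. (p - 1) powr (p / 2) * (\<bar>(indicator E x * f2 x) * (?I x * (H \<bar>f x\<bar> / h \<bar>f x\<bar>))\<bar> powr (p / 2)
      * (?I x * h \<bar>f x\<bar>))) = Y"
    by (auto simp: fun_eq_iff Y_def indicator_def)
  finally show ?thesis .
qed

lemma emeasure_MX: "S \<in> sets lebesgue \<Longrightarrow> emeasure MX S = (\<integral>\<^sup>+x\<in>S. ennreal (X x) \<partial>lebesgue)"
  and emeasure_MY: "S \<in> sets lebesgue \<Longrightarrow> emeasure MY S = (\<integral>\<^sup>+x\<in>S. ennreal (Y x) \<partial>lebesgue)"
  by (simp_all add: MX_def MY_def emeasure_density)

lemma excess_le_compact_pos: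
  assumes "c \<le> d" "{c..d} \<subseteq> E" and pos: "\<And>x. x \<in> {c..d} \<Longrightarrow> f x > 0"
  shows "excess_le MX MY {c..d} (G d - G c)"
proof -
  define s where "s y = (p - 1) * (if p = 2 then 1 else \<bar>y\<bar> powr (p - 2))" for y :: real
  define \<psi> where "\<psi> y = \<bar>y\<bar> powr (p - 2) * y" for y :: real
  define F where "F x = p / 2 * (\<psi> (f1 x) * H (f x))" for x
  define g where "g x = p / 2 * (s (f1 x) * f2 x * H (f x) + \<bar>f1 x\<bar> powr p * h (f x))" for x
  have \<psi>: "(\<psi> has_real_derivative s y) (at y)" for y
    unfolding \<psi>_def[abs_def] s_def by (rule has_real_derivative_signed_power[OF p])
  have FG: "F x = G x" if "x \<in> {c..d}" for x
    using pos[OF that] by (simp add: F_def G_def \<psi>_def)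
  have f1AC: "abs_cont_on {c..d} f1"
    using f1_ac assms by (auto simp: loc_abs_cont_on_def)
  have ac\<psi>: "abs_cont_on {c..d} (\<lambda>x. \<psi> (f1 x))"
    by (rule abs_cont_on_compose_C1[where V = UNIV, OF f1AC _ \<psi>])
       (use continuous_on_signed_power_deriv[OF p] in \<open>auto simp: s_def[abs_def]\<close>)
  have fAC: "abs_cont_on {c..d} f"
    using assms f_deriv f1_cont by (intro abs_cont_on_C1[of _ _ E f f1]) auto
  have acH: "abs_cont_on {c..d} (\<lambda>x. H (f x))"
    by (rule abs_cont_on_compose_C1[OF fAC, of "{0<..}" H h])
       (use pos H_deriv h_cont in auto)
  have acF: "abs_cont_on {c..d} F"
  proof -
    have "abs_cont_on {c..d} (\<lambda>x. \<psi> (f1 x) * H (f x))" by (rule abs_cont_on_mult[OF ac\<psi> acH])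
    then show ?thesis unfolding F_def[abs_def]
      by (rule abs_cont_on_compose_Lipschitz[of _ _ "\<lambda>y. p / 2 * y" "p / 2"])
         (simp only: right_diff_distrib[symmetric] abs_mult, use p in simp)
  qed
  have aeF: "AE x in lebesgue. x \<in> {c..d} \<longrightarrow> (F has_real_derivative g x) (at x)"
    using f2_ae unfolding is_ae_deriv_on_def
  proof eventually_elim
    case (elim x)
    show ?case
    proof
      assume x: "x \<in> {c..d}"
      then have xE: "x \<in> E" using assms by auto
      have "((\<lambda>x. \<psi> (f1 x)) has_real_derivative s (f1 x) * f2 x) (at x)"
        using DERIV_chain2[OF \<psi>, of f1] elim xE by blast
      moreover have "((\<lambda>x. H (f x)) has_real_derivative h (f x) * f1 x) (at x)"
        using DERIV_chain2[OF H_deriv[OF pos[OF x]] f_deriv[OF xE]] .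
      ultimately have "(F has_real_derivative p / 2 *
          (s (f1 x) * f2 x * H (f x) + h (f x) * f1 x * \<psi> (f1 x))) (at x)"
        unfolding F_def[abs_def] by (intro DERIV_cmult DERIV_mult)
      moreover have eq: "\<psi> (f1 x) * f1 x = \<bar>f1 x\<bar> powr p"
      proof (cases "f1 x = 0")
        case False
        then have "\<psi> (f1 x) * f1 x = \<bar>f1 x\<bar> powr (p - 2) * \<bar>f1 x\<bar> powr 2"
          by (simp add: \<psi>_def power2_eq_square mult.assoc)
        also have "\<dots> = \<bar>f1 x\<bar> powr p" by (simp only: powr_add[symmetric]) simp
        finally show ?thesis .
      qed (simp add: \<psi>_def)
      moreover have "h (f x) * f1 x * \<psi> (f1 x) = \<bar>f1 x\<bar> powr p * h (f x)"
        unfolding eq[symmetric] by (simp add: ac_simps)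
      ultimately show "(F has_real_derivative g x) (at x)"
        by (simp add: g_def)
    qed
  qed
  have le: "X x \<le> Y x + g x" if x: "x \<in> {c..d}" for x
  proof -
    have "x \<in> E" "f x > 0" using assms x by auto
    then have X: "X x = \<bar>f1 x\<bar> powr p * h (f x)"
      and Y: "Y x = (p - 1) powr (p / 2) * (\<bar>f2 x * (H (f x) / h (f x))\<bar> powr (p / 2) * h (f x))"
      by (auto simp: X_def Y_def)
    have "2 / p * (X x - Y x) \<le> s (f1 x) * f2 x * H (f x) + \<bar>f1 x\<bar> powr p * h (f x)"
      unfolding X Y s_def by (rule young_pointwise[OF p h_pos[OF \<open>f x > 0\<close>]])
    then have "p / 2 * (2 / p * (X x - Y x)) \<le> g x"
      unfolding g_def using p by (intro mult_left_mono) auto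
    then show ?thesis using p by simp
  qed
  show ?thesis
    unfolding excess_le_def
  proof
    assume fin: "emeasure MY {c..d} < \<infinity>"
    note * = abs_cont_on_nn_integral_le[where X = X, OF \<open>c \<le> d\<close> acF aeF X_nonneg Y_nonneg Y_measurable]
    have le1: "emeasure MX {c..d} \<le> ennreal (measure MY {c..d} + (F d - F c))"
      and le2: "0 \<le> measure MY {c..d} + (F d - F c)"
      using * le fin by (auto simp: emeasure_MX emeasure_MY measure_def)
    have F: "F d - F c = G d - G c" using FG \<open>c \<le> d\<close> by simp
    show "emeasure MX {c..d} < \<infinity> \<and> measure MX {c..d} \<le> measure MY {c..d} + (G d - G c)"
      using le1 le2 enn2real_mono[OF le1] by (auto simp: measure_def F intro: le_less_trans)
  qed
qed

section \<open>Behaviour at the zeros\<close>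

text \<open>
  The crucial step. Suppose that \<open>f\<close> is positive up to a zero \<open>z\<close>, near which the right-hand side
  is finite. Then the boundary term is at most \<open>\<epsilon>\<close> at points arbitrarily close to \<open>z\<close>. When \<open>H\<close> stays
  bounded at \<open>0\<close>, this is clear from \<open>f1 z = 0\<close>. Otherwise put \<open>L t = - H (f t)\<close> and \<open>v t = - f1 t\<close>. If
  the boundary term stayed above \<open>\<epsilon>\<close>, then both would be positive near \<open>z\<close>, so \<open>f\<close> would decrease
  and \<open>L\<close> increase there. Integrating the derivative of \<open>v powr (2 * (p - 1) / p)\<close> up to \<open>z\<close>, where
  \<open>v\<close> vanishes, then makes \<open>v powr (p - 1) * L\<close> small near \<open>z\<close>, a contradiction.
\<close>
lemma boundary_term_small_left_of_zero_pos:
  assumes "r < z" and sub: "{r..z} \<subseteq> E" and pos: "\<And>x. r \<le> x \<Longrightarrow> x < z \<Longrightarrow> f x > 0" and fz: "f z = 0"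
    and fin: "emeasure MY {r..<z} < \<infinity>" and \<epsilon>: "0 < \<epsilon>" and t0: "r \<le> t0" "t0 < z"
  shows "\<exists>t. t0 < t \<and> t < z \<and> G t \<le> \<epsilon>"
proof (rule ccontr)
  assume "\<not> ?thesis"
  then have big: "G t > \<epsilon>" if "t0 < t" "t < z" for t
    using that by force
  have zE: "z \<in> E" using sub \<open>r < z\<close> by auto
  have f1z: "f1 z = 0" using zeros[OF zE fz] .
  have f_lim: "(f \<longlongrightarrow> 0) (at_left z)"
    using DERIV_isCont[OF f_deriv[OF zE]] fz by (auto simp: isCont_def intro: tendsto_within_subset)
  have "isCont f1 z" using f1_cont open_E zE by (simp add: continuous_on_eq_continuous_at)
  then have f1_lim: "(f1 \<longlongrightarrow> 0) (at_left z)"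
    using f1z by (auto simp: isCont_def intro: tendsto_within_subset)
  have near: "\<forall>\<^sub>F t in at_left z. t0 < t \<and> t < z"
    using eventually_at_left_field t0(2) by blast
  have G: "G t = p / 2 * (\<bar>f1 t\<bar> powr (p - 2) * f1 t * H (f t))" if "t0 < t" "t < z" for t
    using pos[of t] t0 that by (simp add: G_def)
  show False
  proof (cases "\<exists>B. \<forall>s. 0 < s \<longrightarrow> s \<le> 1 \<longrightarrow> - B \<le> H s")
    case True
    then obtain B where B: "\<And>s. 0 < s \<Longrightarrow> s \<le> 1 \<Longrightarrow> - B \<le> H s" by blast
    define B' where "B' = \<bar>B\<bar> + \<bar>H 1\<bar>"
    have B': "\<bar>H s\<bar> \<le> B'" if "0 < s" "s \<le> 1" for s
      using B[OF that] H_mono[OF that] by (auto simp: B'_def)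
    have "isCont (\<lambda>y. \<bar>y\<bar> powr (p - 2) * y) (0::real)"
      by (rule DERIV_isCont[OF has_real_derivative_signed_power[OF p]])
    then have "((\<lambda>t. \<bar>f1 t\<bar> powr (p - 2) * f1 t) \<longlongrightarrow> \<bar>0\<bar> powr (p - 2) * 0) (at_left z)"
      by (rule isCont_tendsto_compose[OF _ f1_lim])
    then have "((\<lambda>t. p / 2 * (\<bar>\<bar>f1 t\<bar> powr (p - 2) * f1 t\<bar> * B')) \<longlongrightarrow> p / 2 * (\<bar>\<bar>0\<bar> powr (p - 2) * 0\<bar> * B')) (at_left z)"
      by (rule tendsto_mult[OF tendsto_const tendsto_mult[OF tendsto_rabs tendsto_const]])
    then have "\<forall>\<^sub>F t in at_left z. p / 2 * (\<bar>\<bar>f1 t\<bar> powr (p - 2) * f1 t\<bar> * B') < \<epsilon>"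
      using \<epsilon> by (intro order_tendstoD(2)) auto
    moreover have "\<forall>\<^sub>F t in at_left z. f t < 1"
      using f_lim by (intro order_tendstoD(2)) auto
    ultimately have "\<forall>\<^sub>F t in at_left z. False"
      using near
    proof eventually_elim
      case (elim t)
      then have ft: "0 < f t" "f t \<le> 1" using pos[of t] t0 by auto
      have "G t \<le> p / 2 * (\<bar>\<bar>f1 t\<bar> powr (p - 2) * f1 t\<bar> * B')"
        unfolding G[OF elim(3)[THEN conjunct1] elim(3)[THEN conjunct2]]
      proof (rule mult_left_mono)
        have "\<bar>f1 t\<bar> powr (p - 2) * f1 t * H (f t) \<le> \<bar>\<bar>f1 t\<bar> powr (p - 2) * f1 t\<bar> * \<bar>H (f t)\<bar>"
          by (metis abs_ge_self abs_mult)
        also have "\<dots> \<le> \<bar>\<bar>f1 t\<bar> powr (p - 2) * f1 t\<bar> * B'"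
          by (intro mult_left_mono B' ft) auto
        finally show "\<bar>f1 t\<bar> powr (p - 2) * f1 t * H (f t) \<le> \<bar>\<bar>f1 t\<bar> powr (p - 2) * f1 t\<bar> * B'" .
      qed (use p in auto)
      then show False using big[of t] elim by auto
    qed
    then show False by simp
  next
    case False
    then obtain s0 where s0: "0 < s0" "H s0 < - 1" by (metis not_le)
    have Hneg: "H s < - 1" if "0 < s" "s \<le> s0" for s
      using H_mono[OF that] s0 by simp
    have "\<forall>\<^sub>F t in at_left z. f t < s0"
      using f_lim s0 by (intro order_tendstoD(2)) auto
    then have "\<forall>\<^sub>F t in at_left z. f t < s0 \<and> t0 < t \<and> t < z"
      using near by (rule eventually_conj)
    then obtain t1 where t1: "t1 < z" "\<And>t. t1 < t \<Longrightarrow> t < z \<Longrightarrow> f t < s0 \<and> t0 < t"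
      unfolding eventually_at_left_field by blast
    define L where "L t = - H (f t)" for t
    define v where "v t = - f1 t" for t
    define k where "k = 2 * (p - 1) / p"
    define e0 where "e0 = 2 / p * \<epsilon>"
    define \<rho> where "\<rho> = e0 powr (2 / p)"
    have e0: "e0 > 0" "\<rho> > 0" using \<epsilon> p by (auto simp: e0_def \<rho>_def)
    have k: "k > 0" using p by (simp add: k_def)
    have fpos: "f t > 0" and LB: "L t > 1" and v: "v t > 0" and vL: "v t powr (p - 1) * L t > e0"
      if t: "t1 < t" "t < z" for t
    proof -
      have tt: "t0 < t" "f t \<le> s0" using t1(2)[OF t] by auto
      show f: "f t > 0" using pos tt t t0 by simp
      show LB: "L t > 1" using Hneg[OF f tt(2)] by (simp add: L_def)
      have g: "\<epsilon> < p / 2 * (\<bar>v t\<bar> powr (p - 2) * v t * L t)"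
        using big[OF tt(1) t(2)] G[OF tt(1) t(2)] by (simp add: v_def L_def)
      show v: "v t > 0"
      proof (rule ccontr)
        assume "\<not> ?thesis"
        then have "p / 2 * (\<bar>v t\<bar> powr (p - 2) * v t * L t) \<le> 0"
          using p LB by (intro mult_nonneg_nonpos mult_nonpos_nonneg) auto
        then show False using g \<epsilon> by simp
      qed
      have "v t powr (p - 2) * v t = v t powr (p - 1)"
        using v powr_add[of "v t" "p - 2" 1] by simp
      then show "v t powr (p - 1) * L t > e0"
        using g v p by (simp add: e0_def field_simps)
    qed
    have down: "f y \<le> f x" if "t1 < x" "x \<le> y" "y < z" for x y
    proof (rule DERIV_nonpos_imp_nonincreasing[OF \<open>x \<le> y\<close>])
      fix t assume t: "x \<le> t" "t \<le> y"
      then have tE: "t \<in> E" using sub t1(2)[of t] t0 that by auto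
      moreover have "f1 t \<le> 0" using v[of t] t that by (simp add: v_def)
      ultimately show "\<exists>d. (f has_real_derivative d) (at t) \<and> d \<le> 0" using f_deriv by blast
    qed
    \<comment> \<open>With this \<open>\<eta>\<close>, the coefficient \<open>\<eta> * (p / 2)\<close> below equals \<open>\<rho> / 4\<close>.\<close>
    define \<eta> where "\<eta> = \<rho> / (2 * p)"
    define C where "C = (2 / p) powr (p / 2) * \<eta> powr (1 - p / 2)"
    have \<eta>: "\<eta> > 0" and C: "C > 0" using e0 p by (auto simp: \<eta>_def C_def)
    have decay: "v x powr k \<le> L x powr (- 2 / p) * (\<rho> / 4 + C * measure MY {x..<z})"
      if x: "t1 < x" "x < z" for x
    proof -
      define D where "D = C * L x powr (- 2 / p)"
      have D: "D > 0" using C LB[OF x] by (simp add: D_def)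
      have rx: "r \<le> x" using t1(2)[OF x] t0 by simp
      have step: "v x powr k \<le> \<eta> * (p / 2) * L x powr (- 2 / p) + D * measure MY {x..<z} + v y powr k"
        if y: "x < y" "y < z" for y
      proof -
        define \<Phi> where "\<Phi> t = v t powr k + (- (\<eta> * (p / 2))) * L t powr (- 2 / p)" for t
        define g where "g t = k * v t powr (k - 1) * (- f2 t) + \<eta> * L t powr (- 2 / p - 1) * (h (f t) * v t)" for t
        have xy: "{x..y} \<subseteq> E" "\<And>t. t \<in> {x..y} \<Longrightarrow> t1 < t" "\<And>t. t \<in> {x..y} \<Longrightarrow> t < z"
          using sub rx x y by auto
        have f1AC: "abs_cont_on {x..y} f1"
          using f1_ac xy y by (auto simp: loc_abs_cont_on_def)
        have ac1: "abs_cont_on {x..y} (\<lambda>t. (- f1 t) powr k)"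
        proof (rule abs_cont_on_compose_C1[where V = "{..<0}", OF f1AC, of "\<lambda>y. (- y) powr k" "\<lambda>y. k * (- y) powr (k - 1) * (- 1)"])
          show "f1 ` {x..y} \<subseteq> {..<0}" using v xy by (auto simp: v_def)
          show "((\<lambda>y. (- y) powr k) has_real_derivative k * (- y) powr (k - 1) * (- 1)) (at y)"
            if "y \<in> {..<0}" for y
            using DERIV_fun_powr[OF DERIV_minus[OF DERIV_ident], of y k] that by simp
          show "continuous_on {..<0} (\<lambda>y. k * (- y) powr (k - 1) * (- 1))"
            by (intro continuous_intros) auto
        qed
        have fAC: "abs_cont_on {x..y} f"
          using xy f_deriv f1_cont by (intro abs_cont_on_C1[of _ _ E f f1]) auto
        have LAC: "abs_cont_on {x..y} L"
          unfolding L_def[abs_def]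
          by (rule abs_cont_on_compose_C1[OF fAC, of "{0<..}" "\<lambda>u. - H u" "\<lambda>u. - h u"])
             (use fpos xy H_deriv h_cont in \<open>auto intro!: derivative_intros continuous_intros\<close>)
        have ac2: "abs_cont_on {x..y} (\<lambda>t. (- (\<eta> * (p / 2))) * L t powr (- 2 / p))"
        proof (rule abs_cont_on_compose_C1[OF LAC, of "{0<..}" "\<lambda>u. (- (\<eta> * (p / 2))) * u powr (- 2 / p)"
              "\<lambda>u. (- (\<eta> * (p / 2))) * (- 2 / p * u powr (- 2 / p - 1))"])
          show "L ` {x..y} \<subseteq> {0<..}" using LB xy by fastforce
          show "((\<lambda>u. (- (\<eta> * (p / 2))) * u powr (- 2 / p)) has_real_derivative
              (- (\<eta> * (p / 2))) * (- 2 / p * u powr (- 2 / p - 1))) (at u)" if "u \<in> {0<..}" for u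
            using that by (intro DERIV_cmult has_real_derivative_powr) auto
          show "continuous_on {0<..} (\<lambda>u. (- (\<eta> * (p / 2))) * (- 2 / p * u powr (- 2 / p - 1)))"
            by (intro continuous_intros) auto
        qed
        have ac: "abs_cont_on {x..y} \<Phi>"
          using abs_cont_on_add[OF ac1 ac2] by (simp add: \<Phi>_def[abs_def] v_def)
        have ae: "AE t in lebesgue. t \<in> {x..y} \<longrightarrow> (\<Phi> has_real_derivative g t) (at t)"
          using f2_ae unfolding is_ae_deriv_on_def
        proof eventually_elim
          case (elim t)
          show ?case
          proof
            assume t: "t \<in> {x..y}"
            have tE: "t \<in> E" and tz: "t1 < t" "t < z" using t xy by auto
            have dv: "(v has_real_derivative - f2 t) (at t)"
              unfolding v_def[abs_def] using elim tE by (intro DERIV_minus) auto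
            have dL: "(L has_real_derivative h (f t) * v t) (at t)"
              using DERIV_minus[OF DERIV_chain2[OF H_deriv[OF fpos[OF tz]] f_deriv[OF tE]]]
              by (simp add: L_def[abs_def] v_def)
            have L0: "L t > 0" using LB[OF tz] by simp
            have "(\<Phi> has_real_derivative k * v t powr (k - of_nat 1) * (- f2 t)
                + (- (\<eta> * (p / 2))) * (- 2 / p * L t powr (- 2 / p - of_nat 1) * (h (f t) * v t))) (at t)"
              unfolding \<Phi>_def[abs_def]
              by (intro DERIV_add DERIV_cmult DERIV_fun_powr dv dL v[OF tz] L0)
            moreover have "(- (\<eta> * (p / 2))) * (- 2 / p * L t powr (- 2 / p - of_nat 1) * (h (f t) * v t))
                = \<eta> * L t powr (- 2 / p - 1) * (h (f t) * v t)"
              using p by simp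
            ultimately show "(\<Phi> has_real_derivative g t) (at t)"
              by (simp add: g_def)
          qed
        qed
        have le: "0 \<le> D * Y t + g t" if t: "t \<in> {x..y}" for t
        proof -
          have tE: "t \<in> E" and tz: "t1 < t" "t < z" using t xy by auto
          have f: "f t > 0" using fpos[OF tz] .
          have L0: "L t > 0" "L x > 0" using LB[OF tz] LB[OF x] by auto
          have Y: "Y t = (p - 1) powr (p / 2) * (\<bar>f2 t * (L t / h (f t))\<bar> powr (p / 2) * h (f t))"
            using tE f by (simp add: Y_def L_def abs_mult)
          have "L x \<le> L t"
            using H_mono[OF f down[of x t]] x t tz by (simp add: L_def)
          then have LL: "L t powr (- 2 / p) \<le> L x powr (- 2 / p)"
            using L0 p by (intro powr_mono2') auto
          have "k * v t powr (k - 1) * \<bar>f2 t\<bar>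
              \<le> \<eta> * L t powr (- 2 / p - 1) * (h (f t) * v t) + C * L t powr (- 2 / p) * Y t"
            using power_decay_pointwise[OF p v[OF tz] L0(1) h_pos[OF f] \<eta>, of "f2 t"]
            unfolding Y C_def k_def by simp
          also have "C * L t powr (- 2 / p) * Y t \<le> D * Y t"
            unfolding D_def using C Y_nonneg LL by (intro mult_right_mono mult_left_mono) auto
          finally have "k * v t powr (k - 1) * \<bar>f2 t\<bar>
              \<le> \<eta> * L t powr (- 2 / p - 1) * (h (f t) * v t) + D * Y t" by simp
          moreover have "k * v t powr (k - 1) * f2 t \<le> k * v t powr (k - 1) * \<bar>f2 t\<bar>"
            using k by (intro mult_left_mono) auto
          ultimately show ?thesis by (simp add: g_def)
        qed
        have DY: "(\<integral>\<^sup>+t\<in>{x..y}. ennreal (D * Y t) \<partial>lebesgue) = ennreal D * emeasure MY {x..y}"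
        proof -
          have "(\<integral>\<^sup>+t\<in>{x..y}. ennreal (D * Y t) \<partial>lebesgue)
              = (\<integral>\<^sup>+t. ennreal D * (ennreal (Y t) * indicator {x..y} t) \<partial>lebesgue)"
            using D Y_nonneg by (intro nn_integral_cong) (simp add: ennreal_mult ac_simps)
          also have "\<dots> = ennreal D * (\<integral>\<^sup>+t\<in>{x..y}. ennreal (Y t) \<partial>lebesgue)"
          proof (rule nn_integral_cmult)
            have [measurable]: "{x..y} \<in> sets lebesgue" by simp
            show "(\<lambda>t. ennreal (Y t) * indicator {x..y} t) \<in> borel_measurable lebesgue" by measurable
          qed
          also have "\<dots> = ennreal D * emeasure MY {x..y}"
            by (simp add: emeasure_MY)
          finally show ?thesis .
        qed
        have "emeasure MY {x..y} \<le> emeasure MY {x..<z}" "emeasure MY {x..<z} \<le> emeasure MY {r..<z}"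
          using y rx by (auto intro!: emeasure_mono)
        then have finY: "emeasure MY {x..y} < \<infinity>" "measure MY {x..y} \<le> measure MY {x..<z}"
          using fin by (auto simp: measure_def intro!: enn2real_mono)
        have "0 \<le> enn2real (\<integral>\<^sup>+t\<in>{x..y}. ennreal (D * Y t) \<partial>lebesgue) + (\<Phi> y - \<Phi> x)"
        proof (rule abs_cont_on_nn_integral_le(2)[OF _ ac ae, where X = "\<lambda>_. 0"])
          show "(\<integral>\<^sup>+t\<in>{x..y}. ennreal (D * Y t) \<partial>lebesgue) < \<infinity>"
            using finY by (simp add: DY ennreal_mult_less_top)
          show "(\<lambda>t. D * Y t) \<in> borel_measurable lebesgue" by simp
        qed (use y D Y_nonneg le in auto)
        then have "\<Phi> x \<le> D * measure MY {x..y} + \<Phi> y"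
          using D by (simp add: DY enn2real_mult measure_def)
        also have "\<dots> \<le> D * measure MY {x..<z} + v y powr k"
          using D finY(2) p \<eta> by (intro add_mono mult_left_mono) (auto simp: \<Phi>_def)
        finally show ?thesis by (simp add: \<Phi>_def)
      qed
      have "(v \<longlongrightarrow> - 0) (at_left z)"
        unfolding v_def[abs_def] by (intro tendsto_minus f1_lim)
      then have "((\<lambda>y. \<bar>v y\<bar> powr k) \<longlongrightarrow> \<bar>- 0\<bar> powr k) (at_left z)"
        using k by (intro tendsto_powr' tendsto_rabs tendsto_const) auto
      then have "((\<lambda>y. \<eta> * (p / 2) * L x powr (- 2 / p) + D * measure MY {x..<z} + \<bar>v y\<bar> powr k)
          \<longlongrightarrow> \<eta> * (p / 2) * L x powr (- 2 / p) + D * measure MY {x..<z} + 0) (at_left z)"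
        using k by (intro tendsto_add tendsto_const) simp
      moreover have "\<forall>\<^sub>F y in at_left z. v x powr k
          \<le> \<eta> * (p / 2) * L x powr (- 2 / p) + D * measure MY {x..<z} + \<bar>v y\<bar> powr k"
      proof -
        have "\<forall>\<^sub>F y in at_left z. x < y \<and> y < z"
          using eventually_at_left_field x by blast
        then show ?thesis
        proof eventually_elim
          case (elim y)
          then have "\<bar>v y\<bar> = v y" using v[of y] x by simp
          then show ?case using step[of y] elim by simp
        qed
      qed
      ultimately have "v x powr k \<le> \<eta> * (p / 2) * L x powr (- 2 / p) + D * measure MY {x..<z} + 0"
        by (rule tendsto_lowerbound) simp
      also have "\<eta> * (p / 2) = \<rho> / 4" using p by (simp add: \<eta>_def)
      finally show ?thesis by (simp add: D_def algebra_simps)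
    qed
    have t1': "r \<le> max r t1" "max r t1 < z" using t1 \<open>r < z\<close> by auto
    have "\<rho> / (2 * C) > 0" using e0 C by simp
    then obtain x where x: "max r t1 < x" "x < z" "measure MY {x..<z} < \<rho> / (2 * C)"
      using ex_small_left_tail[OF sets_MY fin \<open>r < z\<close> t1'] by blast
    have x': "t1 < x" "x < z" using x by auto
    have Lx: "L x > 0" using LB[OF x'] by simp
    have "\<rho> < (v x powr (p - 1) * L x) powr (2 / p)"
      unfolding \<rho>_def using e0 vL[OF x'] p by (intro powr_less_mono2) auto
    also have "\<dots> = v x powr k * L x powr (2 / p)"
      using v[OF x'] Lx by (simp add: powr_mult powr_powr k_def mult.commute)
    also have "\<dots> \<le> L x powr (- 2 / p) * (\<rho> / 4 + C * measure MY {x..<z}) * L x powr (2 / p)"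
      by (intro mult_right_mono decay x') auto
    also have "\<dots> = (\<rho> / 4 + C * measure MY {x..<z}) * (L x powr (- 2 / p) * L x powr (2 / p))"
      by (simp add: ac_simps)
    also have "L x powr (- 2 / p) * L x powr (2 / p) = 1"
      using Lx by (simp flip: powr_add)
    also have "C * measure MY {x..<z} < \<rho> / 2"
      using x(3) C by (simp add: field_simps)
    finally show False using e0 by simp
  qed
qed

lemma setting_uminus: "no_single_zero_setting p h H E (\<lambda>x. - f x) (\<lambda>x. - f1 x) (\<lambda>x. - f2 x)"
proof
  show "loc_abs_cont_on E (\<lambda>x. - f1 x)"
    unfolding loc_abs_cont_on_def
  proof (intro allI impI)
    fix c d :: real assume "c \<le> d" "{c..d} \<subseteq> E"
    then have "abs_cont_on {c..d} f1" using f1_ac by (simp add: loc_abs_cont_on_def)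
    then show "abs_cont_on {c..d} (\<lambda>x. - f1 x)"
      by (rule abs_cont_on_compose_Lipschitz[of _ _ uminus 1]) auto
  qed
  show "is_ae_deriv_on E (\<lambda>x. - f1 x) (\<lambda>x. - f2 x)"
    using f2_ae unfolding is_ae_deriv_on_def
    by eventually_elim (auto intro: DERIV_minus)
qed (use p open_E interval_E h_cont h_pos H_deriv f_deriv zeros in \<open>auto intro: DERIV_minus\<close>)

lemma setting_reflect:
  "no_single_zero_setting p h H (uminus ` E) (\<lambda>x. f (- x)) (\<lambda>x. - f1 (- x)) (\<lambda>x. f2 (- x))"
proof
  show "open (uminus ` E)" using open_E by (rule open_negations)
  show "is_interval (uminus ` E)"
    using interval_E by (simp add: is_interval_connected_1 connected_continuous_image continuous_on_minus)
  have refl: "((\<lambda>x. F (- x)) has_real_derivative - D) (at x)"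
    if "(F has_real_derivative D) (at (- x))" for F D x
    using DERIV_chain2[OF that DERIV_minus[OF DERIV_ident]] by simp
  show "((\<lambda>x. f (- x)) has_real_derivative - f1 (- x)) (at x)" if "x \<in> uminus ` E" for x
    using that f_deriv by (intro refl) auto
  have "loc_abs_cont_on (uminus ` E) (\<lambda>x. f1 (- x))"
    by (rule loc_abs_cont_on_reflect[OF f1_ac])
  then show "loc_abs_cont_on (uminus ` E) (\<lambda>x. - f1 (- x))"
    unfolding loc_abs_cont_on_def
    using abs_cont_on_compose_Lipschitz[of _ "\<lambda>x. f1 (- x)" uminus 1] by auto
  show "is_ae_deriv_on (uminus ` E) (\<lambda>x. - f1 (- x)) (\<lambda>x. f2 (- x))"
    using AE_lebesgue_reflect[OF f2_ae[unfolded is_ae_deriv_on_def]]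
    unfolding is_ae_deriv_on_def
  proof eventually_elim
    case (elim x)
    show ?case
    proof
      assume "x \<in> uminus ` E"
      then have "(f1 has_real_derivative f2 (- x)) (at (- x))" using elim by auto
      from DERIV_minus[OF refl[OF this]]
      show "((\<lambda>x. - f1 (- x)) has_real_derivative f2 (- x)) (at x)" by simp
    qed
  qed
qed (use p h_cont h_pos H_deriv zeros in auto)

lemma constant_sign:
  assumes "is_interval S" "S \<subseteq> E" "\<And>x. x \<in> S \<Longrightarrow> f x \<noteq> 0"
  shows "(\<forall>x\<in>S. f x > 0) \<or> (\<forall>x\<in>S. f x < 0)"
proof (rule ccontr)
  assume "\<not> ?thesis"
  then obtain x y where xy: "x \<in> S" "y \<in> S" "f x \<le> 0" "f y \<ge> 0" by force
  have "connected (f ` S)"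
    using assms by (intro connected_continuous_image continuous_on_subset[OF f_cont])
      (auto simp: is_interval_connected_1)
  then have "0 \<in> f ` S"
    using xy by (meson connectedD_interval imageI)
  then show False using assms(3) by force
qed

lemma excess_le_nonzero:
  assumes "c \<le> d" "{c..d} \<subseteq> E" and nz: "\<And>x. x \<in> {c..d} \<Longrightarrow> f x \<noteq> 0"
  shows "excess_le MX MY {c..d} (G d - G c)"
proof -
  have "is_interval {c..d}" by (auto simp: is_interval_1)
  then have "(\<forall>x\<in>{c..d}. f x > 0) \<or> (\<forall>x\<in>{c..d}. f x < 0)"
    using constant_sign assms by blast
  then show ?thesis
  proof
    assume "\<forall>x\<in>{c..d}. f x < 0"
    interpret neg: no_single_zero_setting p h H E "\<lambda>x. - f x" "\<lambda>x. - f1 x" "\<lambda>x. - f2 x"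
      by (rule setting_uminus)
    have "neg.X = X" "neg.Y = Y" "neg.G = G"
      by (auto simp: fun_eq_iff neg.X_def X_def neg.Y_def Y_def neg.G_def G_def sgn_minus)
    then have "neg.MX = MX" "neg.MY = MY" "neg.G = G"
      by (auto simp: neg.MX_def MX_def neg.MY_def MY_def)
    then show ?thesis
      using neg.excess_le_compact_pos[OF assms(1,2)] \<open>\<forall>x\<in>{c..d}. f x < 0\<close> by simp
  qed (use assms in \<open>auto intro: excess_le_compact_pos\<close>)
qed

lemma boundary_term_small_left_of_zero:
  assumes "r < z" and sub: "{r..z} \<subseteq> E" and nz: "\<And>x. r \<le> x \<Longrightarrow> x < z \<Longrightarrow> f x \<noteq> 0" and fz: "f z = 0"
    and fin: "emeasure MY {r..<z} < \<infinity>" and \<epsilon>: "0 < \<epsilon>" and t0: "r \<le> t0" "t0 < z"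
  shows "\<exists>t. t0 < t \<and> t < z \<and> G t \<le> \<epsilon>"
proof -
  have "is_interval {r..<z}" by (auto simp: is_interval_1)
  then consider "\<And>x. r \<le> x \<Longrightarrow> x < z \<Longrightarrow> f x > 0" | "\<And>x. r \<le> x \<Longrightarrow> x < z \<Longrightarrow> f x < 0"
    using constant_sign[of "{r..<z}"] sub nz by fastforce
  then show ?thesis
  proof cases
    case 1
    then show ?thesis by (intro boundary_term_small_left_of_zero_pos[OF assms(1,2) _ fz fin \<epsilon> t0])
  next
    case 2
    interpret neg: no_single_zero_setting p h H E "\<lambda>x. - f x" "\<lambda>x. - f1 x" "\<lambda>x. - f2 x"
      by (rule setting_uminus)
    have eq: "neg.Y = Y" "neg.G = G"
      by (auto simp: fun_eq_iff neg.Y_def Y_def neg.G_def G_def sgn_minus)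
    then have "neg.MY = MY" by (auto simp: neg.MY_def MY_def)
    then show ?thesis
      using neg.boundary_term_small_left_of_zero_pos[OF assms(1,2) _ _ _ \<epsilon> t0] 2 fz fin
      by (simp add: eq)
  qed
qed

lemma excess_le_left_of_zero:
  assumes "r < z" and sub: "{r..z} \<subseteq> E" and nz: "\<And>x. r \<le> x \<Longrightarrow> x < z \<Longrightarrow> f x \<noteq> 0" and fz: "f z = 0"
  shows "excess_le MX MY {r..<z} (- G r)"
proof (rule excess_le_limit_right[OF \<open>r < z\<close> sets_MX sets_MY])
  fix \<epsilon> t0 :: real
  assume "emeasure MY {r..<z} < \<infinity>" "0 < \<epsilon>" and t0: "r \<le> t0" "t0 < z"
  then obtain t where t: "t0 < t" "t < z" "G t \<le> \<epsilon>"
    using boundary_term_small_left_of_zero[OF assms] by blast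
  have "excess_le MX MY {r..t} (G t - G r)"
    using t t0 sub nz by (intro excess_le_nonzero) auto
  then have "excess_le MX MY {r..t} (- G r + \<epsilon>)"
    by (rule excess_le_mono) (use t in simp)
  then show "\<exists>t>t0. t < z \<and> excess_le MX MY {r..t} (- G r + \<epsilon>)" using t by blast
qed

lemma excess_le_right_of_zero:
  assumes "z < r" and sub: "{z..r} \<subseteq> E" and nz: "\<And>x. z < x \<Longrightarrow> x \<le> r \<Longrightarrow> f x \<noteq> 0" and fz: "f z = 0"
  shows "excess_le MX MY {z<..r} (G r)"
proof -
  interpret rf: no_single_zero_setting p h H "uminus ` E" "\<lambda>x. f (- x)" "\<lambda>x. - f1 (- x)" "\<lambda>x. f2 (- x)"
    by (rule setting_reflect)
  have mem: "x \<in> uminus ` E \<longleftrightarrow> - x \<in> E" for x by force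
  have eq: "rf.X x = X (- x)" "rf.Y x = Y (- x)" "rf.G x = - G (- x)" for x
    by (auto simp: rf.X_def X_def rf.Y_def Y_def rf.G_def G_def mem indicator_def)
  have aff: "(\<integral>\<^sup>+x. \<phi> (- x) \<partial>lebesgue) = (\<integral>\<^sup>+x. \<phi> x \<partial>lebesgue)"
    if "\<phi> \<in> borel_measurable lebesgue" for \<phi> :: "real \<Rightarrow> ennreal"
    using nn_integral_real_affine_lebesgue[OF that, of "- 1" 0] by simp
  have meas: "(\<integral>\<^sup>+x\<in>{- r..<- z}. ennreal (\<psi> (- x)) \<partial>lebesgue) = (\<integral>\<^sup>+x\<in>{z<..r}. ennreal (\<psi> x) \<partial>lebesgue)"
    if [measurable]: "\<psi> \<in> borel_measurable lebesgue" for \<psi> :: "real \<Rightarrow> real"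
  proof -
    have [measurable]: "{z<..r} \<in> sets lebesgue" by simp
    have "(\<integral>\<^sup>+x\<in>{z<..r}. ennreal (\<psi> x) \<partial>lebesgue)
        = (\<integral>\<^sup>+x. ennreal (\<psi> (- x)) * indicator {z<..r} (- x) \<partial>lebesgue)"
      by (rule aff[symmetric]) measurable
    also have "\<dots> = (\<integral>\<^sup>+x\<in>{- r..<- z}. ennreal (\<psi> (- x)) \<partial>lebesgue)"
      by (intro nn_integral_cong) (auto simp: indicator_def)
    finally show ?thesis ..
  qed
  have em: "emeasure rf.MX {- r..<- z} = emeasure MX {z<..r}" "emeasure rf.MY {- r..<- z} = emeasure MY {z<..r}"
    by (simp_all add: rf.emeasure_MX rf.emeasure_MY emeasure_MX emeasure_MY eq meas)
  have "{- r..- z} \<subseteq> uminus ` E"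
    by (auto simp: mem intro!: subsetD[OF sub])
  then have "excess_le rf.MX rf.MY {- r..<- z} (- rf.G (- r))"
    using assms by (intro rf.excess_le_left_of_zero) auto
  then show ?thesis
    by (simp add: excess_le_def em measure_def eq)
qed

lemma singleton_null: "{x} \<in> null_sets MX" "{x} \<in> null_sets MY"
proof -
  have "{x} \<in> null_sets lebesgue" by (simp add: negligible_iff_null_sets[symmetric])
  then show "{x} \<in> null_sets MX" "{x} \<in> null_sets MY"
    using absolutely_continuousI_density[of "\<lambda>x. ennreal (X x)" lebesgue]
      absolutely_continuousI_density[of "\<lambda>x. ennreal (Y x)" lebesgue]
    by (auto simp: absolutely_continuous_def MX_def MY_def)
qed

lemma excess_le_between_zeros:
  assumes "z1 \<le> z2" and sub: "{z1..z2} \<subseteq> E" and z: "f z1 = 0" "f z2 = 0"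
  shows "excess_le MX MY {z1..z2} 0"
proof -
  define U where "U = {z1<..<z2} \<inter> {x \<in> E. f x \<noteq> 0}"
  have opU: "open U" unfolding U_def by (intro open_Int open_nonzero) auto
  have comp: "emeasure MX C \<le> emeasure MY C" if CU: "C \<in> components U" for C
  proof -
    obtain \<alpha> \<beta> where C: "\<alpha> < \<beta>" "C = {\<alpha><..<\<beta>}" "\<alpha> \<in> {z1..z2} - U" "\<beta> \<in> {z1..z2} - U"
      by (rule open_interval_components[OF opU _ CU, of z1 z2]) (auto simp: U_def)
    have ends: "f \<alpha> = 0" "f \<beta> = 0" using C(3,4) z sub by (force simp: U_def)+
    have nz: "f x \<noteq> 0" if "\<alpha> < x" "x < \<beta>" for x
      using in_components_subset[OF CU] that C(2) by (auto simp: U_def)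
    define m where "m = (\<alpha> + \<beta>) / 2"
    have m: "\<alpha> < m" "m < \<beta>" using C(1) by (auto simp: m_def)
    have 1: "excess_le MX MY {\<alpha><..m} (G m)"
      using m C sub nz ends by (intro excess_le_right_of_zero) auto
    have "excess_le MX MY {m..<\<beta>} (- G m)"
      using m C sub nz ends by (intro excess_le_left_of_zero) auto
    moreover have "{m..<\<beta>} = {m<..<\<beta>} \<union> {m}" using m by auto
    ultimately have 2: "excess_le MX MY {m<..<\<beta>} (- G m)"
      using singleton_null[of m]
      by (simp add: excess_le_def measure_def emeasure_Un_null_set del: Un_insert_right)
    have "excess_le MX MY ({\<alpha><..m} \<union> {m<..<\<beta>}) (G m + - G m)"
      by (rule excess_le_Un[OF 1 2]) auto
    moreover have "{\<alpha><..m} \<union> {m<..<\<beta>} = C" using m C by auto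
    ultimately show ?thesis
      using excess_le_emeasure[of MX MY C 0 0] by simp
  qed
  have U: "emeasure MX {z1..z2} = emeasure MX U" "emeasure MY {z1..z2} = emeasure MY U"
    using opU z by (auto simp: emeasure_MX emeasure_MY X_def Y_def U_def indicator_def less_le
        intro!: nn_integral_cong)
  show ?thesis
    using emeasure_le_components[OF opU sets_MX sets_MY comp]
    by (intro excess_leI_emeasure) (simp add: U)
qed

text \<open>
  Zeros inside the interval leave no trace in the defect: up to the first zero it is \<open>- G r\<close>,
  from the last zero on it is \<open>G R\<close>, and in between it is zero.
\<close>
lemma excess_le_compact:
  assumes "r \<le> R" and sub: "{r..R} \<subseteq> E"
  shows "excess_le MX MY {r..R} (G R - G r)"
proof (cases "\<exists>x\<in>{r..R}. f x = 0")
  case False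
  then show ?thesis using assms by (intro excess_le_nonzero) auto
next
  case True
  define Z where "Z = {x \<in> {r..R}. f x = 0}"
  have "closed ({r..R} \<inter> f -` {0})"
    using continuous_on_subset[OF f_cont sub] by (intro continuous_closed_preimage) auto
  moreover have "{r..R} \<inter> f -` {0} = Z" by (auto simp: Z_def)
  moreover have "bounded Z" by (rule bounded_subset[of "{r..R}"]) (auto simp: Z_def)
  ultimately have "compact Z" by (simp add: compact_eq_bounded_closed)
  moreover have "Z \<noteq> {}" using True by (auto simp: Z_def)
  ultimately obtain z1 z2 where z: "z1 \<in> Z" "z2 \<in> Z" "\<And>x. x \<in> Z \<Longrightarrow> z1 \<le> x" "\<And>x. x \<in> Z \<Longrightarrow> x \<le> z2"
    by (metis compact_attains_inf compact_attains_sup)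
  have zz: "r \<le> z1" "z1 \<le> z2" "z2 \<le> R" "f z1 = 0" "f z2 = 0"
    using z by (auto simp: Z_def)
  have 1: "excess_le MX MY {r..<z1} (- G r)"
  proof (cases "r = z1")
    case True
    then show ?thesis using zz by (simp add: excess_le_def G_def)
  next
    case False
    moreover have "f x \<noteq> 0" if "r \<le> x" "x < z1" for x
      using z(3)[of x] that zz by (auto simp: Z_def)
    ultimately show ?thesis
      using zz sub by (intro excess_le_left_of_zero) auto
  qed
  have 2: "excess_le MX MY {z1..z2} 0"
    using zz sub by (intro excess_le_between_zeros) auto
  have 3: "excess_le MX MY {z2<..R} (G R)"
  proof (cases "R = z2")
    case True
    then show ?thesis using zz by (simp add: excess_le_def G_def)
  next
    case False
    moreover have "f x \<noteq> 0" if "z2 < x" "x \<le> R" for x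
      using z(4)[of x] that zz by (auto simp: Z_def)
    ultimately show ?thesis
      using zz sub by (intro excess_le_right_of_zero) auto
  qed
  have "excess_le MX MY ({r..<z1} \<union> {z1..z2}) (- G r + 0)"
    by (rule excess_le_Un[OF 1 2]) auto
  then have "excess_le MX MY ({r..<z1} \<union> {z1..z2} \<union> {z2<..R}) (- G r + 0 + G R)"
    by (rule excess_le_Un[OF _ 3]) (use zz in auto)
  moreover have "{r..<z1} \<union> {z1..z2} \<union> {z2<..R} = {r..R}" using zz by auto
  ultimately show ?thesis by simp
qed

lemma emeasure_le_of_small_boundary_terms:
  assumes E: "E = einterval a b" and "a < b"
    and small: "\<And>\<epsilon> c d. 0 < \<epsilon> \<Longrightarrow> c \<in> E \<Longrightarrow> d \<in> E \<Longrightarrow>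
        \<exists>r\<in>E. \<exists>R\<in>E. r \<le> c \<and> d \<le> R \<and> G R - G r \<le> \<epsilon>"
  shows "emeasure MX E \<le> emeasure MY E"
proof (rule ennreal_le_epsilon)
  fix \<epsilon> :: real assume "0 < \<epsilon>"
  obtain u l :: "nat \<Rightarrow> real" where ul: "einterval a b = (\<Union>i. {l i .. u i})" "incseq u" "decseq l"
    "\<And>i. l i < u i"
    by (rule einterval_Icc_approximation[OF \<open>a < b\<close>]) (rule that; assumption)
  have inc: "incseq (\<lambda>i. {l i..u i})"
  proof (rule incseq_SucI)
    fix n
    show "{l n..u n} \<subseteq> {l (Suc n)..u (Suc n)}"
      using incseq_SucD[OF ul(2), of n] decseq_SucD[OF ul(3), of n] by auto
  qed
  have UN_E: "(\<Union>i. {l i..u i}) = E" using E ul(1) by simp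
  have "emeasure MX E = (SUP i. emeasure MX {l i..u i})"
    using SUP_emeasure_incseq[OF _ inc, of MX] unfolding UN_E by (simp add: image_subset_iff)
  also have "\<dots> \<le> emeasure MY E + ennreal \<epsilon>"
  proof (rule SUP_least)
    fix i
    have "{l i..u i} \<subseteq> E" using UN_E by blast
    then have "l i \<in> E" "u i \<in> E" using ul(4)[of i] by auto
    then obtain r R where rR: "r \<in> E" "R \<in> E" "r \<le> l i" "u i \<le> R" "G R - G r \<le> \<epsilon>"
      using small[OF \<open>0 < \<epsilon>\<close>] by metis
    have "emeasure MX {l i..u i} \<le> emeasure MX {r..R}"
      using rR by (intro emeasure_mono) auto
    also have "\<dots> \<le> emeasure MY {r..R} + ennreal \<epsilon>"
    proof (rule excess_le_emeasure[OF _ rR(5)])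
      show "excess_le MX MY {r..R} (G R - G r)"
        using rR ul(4)[of i] by (intro excess_le_compact Icc_subset_E) auto
    qed (use \<open>0 < \<epsilon>\<close> in simp)
    also have "\<dots> \<le> emeasure MY E + ennreal \<epsilon>"
      using Icc_subset_E[OF rR(1,2)] open_E by (intro add_right_mono emeasure_mono) auto
    finally show "emeasure MX {l i..u i} \<le> emeasure MY E + ennreal \<epsilon>" .
  qed
  finally show "emeasure MX E \<le> emeasure MY E + ennreal \<epsilon>" .
qed

end

section \<open>The boundary conditions and the inequality\<close>

lemma Liminf_left_ex:
  assumes "a < b" "d \<in> einterval a b" "liminf_left b F < ereal C"
  shows "\<exists>R\<in>einterval a b. d \<le> R \<and> F R < C"
proof (rule ccontr)
  assume "\<not> ?thesis"
  then have *: "C \<le> F R" if "R \<in> einterval a b" "d \<le> R" for R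
    using that by force
  have d: "a < ereal d" "ereal d < b" using assms by (auto simp: einterval_def)
  have "\<forall>\<^sub>F x in at_left b. ereal C \<le> ereal (F (real_of_ereal x))"
    unfolding eventually_at_left[OF d(2)]
  proof (intro exI[of _ "ereal d"] conjI allI impI d)
    fix x assume x: "ereal d < x" "x < b"
    then obtain R where "x = ereal R" by (cases x) auto
    then show "ereal C \<le> ereal (F (real_of_ereal x))"
      using x d by (auto simp: einterval_def intro!: * less_trans[OF d(1)])
  qed
  then have "ereal C \<le> liminf_left b F"
    unfolding liminf_left_def by (rule Liminf_bounded)
  then show False using assms by simp
qed

lemma Limsup_right_ex:
  assumes "a < b" "c \<in> einterval a b" "ereal C < limsup_right a F"
  shows "\<exists>r\<in>einterval a b. r \<le> c \<and> C < F r"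
proof (rule ccontr)
  assume "\<not> ?thesis"
  then have *: "F r \<le> C" if "r \<in> einterval a b" "r \<le> c" for r
    using that by force
  have c: "a < ereal c" "ereal c < b" using assms by (auto simp: einterval_def)
  have "\<forall>\<^sub>F x in at_right a. ereal (F (real_of_ereal x)) \<le> ereal C"
    unfolding eventually_at_right[OF c(1)]
  proof (intro exI[of _ "ereal c"] conjI allI impI c)
    fix x assume x: "a < x" "x < ereal c"
    then obtain r where "x = ereal r" by (cases x) auto
    then show "ereal (F (real_of_ereal x)) \<le> ereal C"
      using x c by (auto simp: einterval_def intro!: * less_trans[OF _ c(2)])
  qed
  then have "limsup_right a F \<le> ereal C"
    unfolding limsup_right_def by (rule Limsup_bounded)
  then show False using assms by simp
qed

lemma abs_cont_primitive_has_real_derivative: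
  assumes H: "loc_abs_cont_on {0<..} H" "is_ae_deriv_on {0<..} H h" and h: "continuous_on {0<..} h"
    and "t > 0"
  shows "(H has_real_derivative h t) (at t)"
proof -
  define s u where "s = t / 2" "u = 2 * t"
  have su: "0 < s" "s < t" "t < u" using \<open>t > 0\<close> by (auto simp: s_u_def)
  have eq: "H y = H s + integral {s..y} h" if y: "s \<le> y" for y
  proof -
    have "(h has_integral (H y - H s)) {s..y}"
    proof (rule abs_cont_on_has_integral[OF y])
      have "{s..y} \<subseteq> {0<..}" using su by auto
      then show "abs_cont_on {s..y} H" using H(1) y by (simp add: loc_abs_cont_on_def)
      show "AE x in lebesgue. x \<in> {s..y} \<longrightarrow> (H has_real_derivative h x) (at x)"
        using H(2) unfolding is_ae_deriv_on_def
        by eventually_elim (use su in auto)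
    qed
    then show ?thesis by (simp add: integral_unique)
  qed
  have "((\<lambda>y. integral {s..y} h) has_real_derivative h t) (at t within {s..u})"
    using su by (intro integral_has_real_derivative continuous_on_subset[OF h]) auto
  then have "((\<lambda>y. integral {s..y} h) has_real_derivative h t) (at t)"
    using su by (simp add: at_within_Icc_at)
  from DERIV_add[OF DERIV_const this]
  have D: "((\<lambda>y. H s + integral {s..y} h) has_real_derivative h t) (at t)" by simp
  have ev: "\<forall>\<^sub>F y in nhds t. H s + integral {s..y} h = H y"
  proof -
    have "\<forall>\<^sub>F y in nhds t. y \<in> {s<..}"
      using su by (intro eventually_nhds_in_open) auto
    then show ?thesis
    proof eventually_elim
      case (elim y)
      then show ?case using eq[of y] by simp
    qed
  qed
  show ?thesis
    by (rule DERIV_cong_ev[OF refl ev refl, THEN iffD1, OF D])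
qed

theorem proposition5p1:
  fixes p :: real and a b :: ereal and h H f f'' :: "real \<Rightarrow> real"
  assumes "p \<ge> 2" and "a < b"
    and "continuous_on {0<..} h" and "\<And>t. t > 0 \<Longrightarrow> h t > 0"
    and "loc_abs_cont_on {0<..} H" and "is_ae_deriv_on {0<..} H h"
    and "f \<in> W21_loc a b" and "is_ae_deriv_on (einterval a b) (deriv f) f''"
    and "no_single_zeroes a b f"
    and "boundary_cond_1 p a b H f \<or> boundary_cond_2 p a b h H f"
  shows "(\<integral>\<^sup>+ x \<in> einterval a b \<inter> {x. f x \<noteq> 0}.
            ennreal (\<bar>deriv f x\<bar> powr p * h \<bar>f x\<bar>) \<partial>lebesgue)
         \<le> ennreal (sqrt (p - 1) powr p) *
           (\<integral>\<^sup>+ x \<in> einterval a b \<inter> {x. f x \<noteq> 0}.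
              ennreal (\<bar>f'' x * T_trans H h \<bar>f x\<bar>\<bar> powr (p / 2) * h \<bar>f x\<bar>) \<partial>lebesgue)"
proof -
  define E where "E = einterval a b"
  interpret no_single_zero_setting p h H E f "deriv f" f''
  proof
    show "open E" by (simp add: E_def)
    show "is_interval E"
      unfolding is_interval_1 E_def einterval_def
      by (auto; metis ereal_less_eq(3) le_less_trans less_le_trans)
    show "(H has_real_derivative h t) (at t)" if "t > 0" for t
      by (rule abs_cont_primitive_has_real_derivative[OF assms(5,6,3) that])
    show "(f has_real_derivative deriv f x) (at x)" if "x \<in> E" for x
      using that assms(7) DERIV_deriv_iff_real_differentiable by (auto simp: W21_loc_def E_def)
  qed (use assms in \<open>auto simp: W21_loc_def no_single_zeroes_def E_def\<close>)
  have bdry_eq: "G x = p / 2 * bdry p K f x" if K: "\<And>t. t > 0 \<Longrightarrow> K t = H t" for K x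
    using K[of "\<bar>f x\<bar>"] by (cases "f x = 0") (simp_all add: G_def bdry_def)
  \<comment> \<open>Either boundary condition yields a level that separates the boundary terms up to any error.\<close>
  have "\<exists>K. (\<forall>t>0. K t = H t) \<and>
      (\<forall>\<epsilon>>0. \<exists>c. liminf_left b (bdry p K f) < ereal (c + \<epsilon>) \<and> ereal (c - \<epsilon>) < limsup_right a (bdry p K f))"
    using assms(10)
  proof
    assume "boundary_cond_1 p a b H f"
    then obtain K where K: "\<forall>t>0. K t = H t" "liminf_left b (bdry p K f) \<le> 0" "0 \<le> limsup_right a (bdry p K f)"
      by (auto simp: boundary_cond_1_def)
    have "liminf_left b (bdry p K f) < ereal (0 + \<epsilon>) \<and> ereal (0 - \<epsilon>) < limsup_right a (bdry p K f)"
      if "\<epsilon> > 0" for \<epsilon>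
      by (intro conjI le_less_trans[OF K(2)] less_le_trans[OF _ K(3)]) (use that in simp_all)
    then show ?thesis using K(1) by blast
  next
    assume "boundary_cond_2 p a b h H f"
    define K where "K = (\<lambda>t. if t = 0 then 0 else H t)"
    define l s where "l = liminf_left b (bdry p K f)" "s = limsup_right a (bdry p K f)"
    have ls: "l - s \<le> 0"
      using \<open>boundary_cond_2 p a b h H f\<close> by (simp add: boundary_cond_2_def K_def l_s_def Let_def)
    \<comment> \<open>Subtraction of extended reals yields \<open>\<infinity>\<close> if \<open>l = \<infinity>\<close> or \<open>s = -\<infinity>\<close>, so \<open>ls\<close> excludes these cases.\<close>
    have "\<exists>c. l < ereal (c + \<epsilon>) \<and> ereal (c - \<epsilon>) < s" if "\<epsilon> > 0" for \<epsilon>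
    proof (cases l)
      case (real x)
      then show ?thesis using ls that by (cases s) (auto intro!: exI[of _ x])
    next
      case MInf
      then show ?thesis using ls that by (cases s) (auto intro: exI[of _ "real_of_ereal s"])
    qed (use ls in \<open>cases s; auto\<close>)
    then show ?thesis
      by (intro exI[of _ K]) (auto simp: K_def l_s_def)
  qed
  then obtain K where K: "\<And>t. t > 0 \<Longrightarrow> K t = H t"
    and sep: "\<And>\<epsilon>. \<epsilon> > 0 \<Longrightarrow> \<exists>c. liminf_left b (bdry p K f) < ereal (c + \<epsilon>) \<and> ereal (c - \<epsilon>) < limsup_right a (bdry p K f)"
    by blast
  have main: "emeasure MX E \<le> emeasure MY E"
  proof (rule emeasure_le_of_small_boundary_terms[OF E_def \<open>a < b\<close>])
    fix \<epsilon> c d :: real assume \<epsilon>: "0 < \<epsilon>" and cd: "c \<in> E" "d \<in> E"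
    have "\<epsilon> / p > 0" using \<epsilon> p by simp
    then obtain C where C: "liminf_left b (bdry p K f) < ereal (C + \<epsilon> / p)"
      "ereal (C - \<epsilon> / p) < limsup_right a (bdry p K f)"
      using sep by blast
    obtain R where R: "R \<in> E" "d \<le> R" "bdry p K f R < C + \<epsilon> / p"
      using Liminf_left_ex[OF \<open>a < b\<close> _ C(1)] cd by (auto simp: E_def)
    obtain r where r: "r \<in> E" "r \<le> c" "C - \<epsilon> / p < bdry p K f r"
      using Limsup_right_ex[OF \<open>a < b\<close> _ C(2)] cd by (auto simp: E_def)
    have "G R - G r = p / 2 * (bdry p K f R - bdry p K f r)"
      using bdry_eq[of K R] bdry_eq[of K r] K by (simp add: right_diff_distrib)
    also have "\<dots> \<le> p / 2 * (2 * (\<epsilon> / p))"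
      using R(3) r(3) p by (intro mult_left_mono) auto
    also have "\<dots> = \<epsilon>" using p by simp
    finally show "\<exists>r\<in>E. \<exists>R\<in>E. r \<le> c \<and> d \<le> R \<and> G R - G r \<le> \<epsilon>"
      using R r by blast
  qed
  have c: "sqrt (p - 1) powr p = (p - 1) powr (p / 2)" "(p - 1) powr (p / 2) > 0"
    using p by (simp_all add: powr_half_sqrt[symmetric] powr_powr)
  have [measurable]: "E \<in> sets lebesgue" using open_E by simp
  have "emeasure MX E = (\<integral>\<^sup>+ x \<in> einterval a b \<inter> {x. f x \<noteq> 0}.
            ennreal (\<bar>deriv f x\<bar> powr p * h \<bar>f x\<bar>) \<partial>lebesgue)"
  proof -
    have "emeasure MX E = (\<integral>\<^sup>+x\<in>E. ennreal (X x) \<partial>lebesgue)"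
      by (rule emeasure_MX) measurable
    also have "\<dots> = (\<integral>\<^sup>+ x \<in> einterval a b \<inter> {x. f x \<noteq> 0}.
            ennreal (\<bar>deriv f x\<bar> powr p * h \<bar>f x\<bar>) \<partial>lebesgue)"
      by (intro nn_integral_cong) (auto simp: X_def E_def[symmetric] indicator_def)
    finally show ?thesis .
  qed
  moreover have "emeasure MY E = ennreal (sqrt (p - 1) powr p) *
           (\<integral>\<^sup>+ x \<in> einterval a b \<inter> {x. f x \<noteq> 0}.
              ennreal (\<bar>f'' x * T_trans H h \<bar>f x\<bar>\<bar> powr (p / 2) * h \<bar>f x\<bar>) \<partial>lebesgue)"
  proof -
    have "emeasure MY E = (\<integral>\<^sup>+ x. ennreal ((p - 1) powr (p / 2)) *
        (ennreal (Y x / (p - 1) powr (p / 2)) * indicator E x) \<partial>lebesgue)"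
      using c Y_nonneg
      by (auto simp: emeasure_MY indicator_def ennreal_mult[symmetric] intro!: nn_integral_cong)
    also have "\<dots> = ennreal ((p - 1) powr (p / 2)) *
        (\<integral>\<^sup>+ x. ennreal (Y x / (p - 1) powr (p / 2)) * indicator E x \<partial>lebesgue)"
      by (rule nn_integral_cmult) measurable
    also have "(\<integral>\<^sup>+ x. ennreal (Y x / (p - 1) powr (p / 2)) * indicator E x \<partial>lebesgue)
        = (\<integral>\<^sup>+ x \<in> einterval a b \<inter> {x. f x \<noteq> 0}.
              ennreal (\<bar>f'' x * T_trans H h \<bar>f x\<bar>\<bar> powr (p / 2) * h \<bar>f x\<bar>) \<partial>lebesgue)"
      using c by (intro nn_integral_cong) (auto simp: Y_def E_def[symmetric] T_trans_def indicator_def)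
    finally show ?thesis by (simp add: c(1))
  qed
  ultimately show ?thesis using main by simp
qed

end
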